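(* Let $n\ge 1$ be an integer. If $n\le 3$, then $\mathrm{Isom}\,\mathbb{H}_n$ (acting on $\mathbb{H}_n$) is fixating. If $n\ge 5$, then $\mathrm{Isom}\,\mathbb{H}_n$ is not fixating.
   Context: $\mathbb{H}_n$ is the $n$-dimensional hyperbolic space, in the upper half-space model $\{(x_1,\dots,x_n)\in\mathbb{R}^n: x_n>0\}$ with the Poincaré metric $ds^2=\frac{1}{x_n^2}\sum_{i=1}^n dx_i^2$, whose geodesic distance is $d(x,y)=\operatorname{argcosh}\big(1+\frac{\|x-y\|^2}{2x_ny_n}\big)$. $\mathrm{Isom}\,\mathbb{H}_n$ is the group of all its isometries (distance-preserving bijections). For a bijection $g$ of a set $X$, $\mathrm{Fix}\,g=\{x\in X: g(x)=x\}$. A group $H$ of bijections of $X$ is a GAF if $\mathrm{Fix}\,g\neq\emptyset$ for every $g\in H$; it is a GAG if $\bigcap_{g\in H}\mathrm{Fix}\,g\ne\emptyset$. A group $G$ of bijections of $X$ is fixating if every subgroup of $G$ that is a GAF is a GAG. *)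

theory Defs
  imports "HOL-Analysis.Analysis" "HOL-Algebra.Bij"
begin

section \<open>Fixating groups of bijections\<close>

text \<open>
  A group of bijections of a set \<open>X\<close> is a subgroup of \<^term>\<open>BijGroup X\<close>, whose elements
  are the bijections of \<open>X\<close> onto itself, represented as functions that are undefined
  outside \<open>X\<close>. In the following definitions \<open>G\<close> and \<open>H\<close> are meant to be such groups.
\<close>

definition Fix :: "'a set \<Rightarrow> ('a \<Rightarrow> 'a) \<Rightarrow> 'a set" where
  "Fix X g = {x \<in> X. g x = x}"

definition GAF :: "'a set \<Rightarrow> ('a \<Rightarrow> 'a) set \<Rightarrow> bool" where
  "GAF X H \<longleftrightarrow> (\<forall>g\<in>H. Fix X g \<noteq> {})"

definition GAG :: "'a set \<Rightarrow> ('a \<Rightarrow> 'a) set \<Rightarrow> bool" where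
  "GAG X H \<longleftrightarrow> (\<Inter>g\<in>H. Fix X g) \<noteq> {}"

definition fixating :: "'a set \<Rightarrow> ('a \<Rightarrow> 'a) set \<Rightarrow> bool" where
  "fixating X G \<longleftrightarrow>
     (\<forall>H. subgroup H ((BijGroup X)\<lparr>carrier := G\<rparr>) \<longrightarrow> GAF X H \<longrightarrow> GAG X H)"


section \<open>Hyperbolic space\<close>

text \<open>
  The coordinates are indexed by a finite linearly ordered type \<open>'n\<close>, so that
  \<open>n = CARD('n) \<ge> 1\<close> and the largest index plays the role of \<open>n\<close> in \<open>x\<^sub>n\<close>.
\<close>

definition last_coord :: "real ^ 'n::{finite,linorder} \<Rightarrow> real" where
  "last_coord x = x $ Max UNIV"

definition hyp_space :: "(real ^ 'n::{finite,linorder}) set" where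
  "hyp_space = {x. last_coord x > 0}"

text \<open>
  The geodesic distance of the Poincare metric, given by its closed form. It is only
  meaningful for points of \<^const>\<open>hyp_space\<close>.
\<close>

definition hyp_dist :: "real ^ 'n::{finite,linorder} \<Rightarrow> real ^ 'n::{finite,linorder} \<Rightarrow> real" where
  "hyp_dist x y = arcosh (1 + (norm (x - y))\<^sup>2 / (2 * last_coord x * last_coord y))"

definition hyp_isometries :: "(real ^ 'n::{finite,linorder} \<Rightarrow> real ^ 'n::{finite,linorder}) set" where
  "hyp_isometries =
     {g \<in> carrier (BijGroup hyp_space).
        \<forall>x\<in>hyp_space. \<forall>y\<in>hyp_space. hyp_dist (g x) (g y) = hyp_dist x y}"

text \<open>\<^const>\<open>fixating\<close> is thus applied to a group of bijections.\<close>

lemma subgroup_hyp_isometries: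
  "subgroup (hyp_isometries :: (real ^ 'n::{finite,linorder} \<Rightarrow> real ^ 'n::{finite,linorder}) set)
     (BijGroup hyp_space)"
proof (rule group.subgroupI[OF group_BijGroup])
  let ?I = "hyp_isometries :: (real ^ 'n::{finite,linorder} \<Rightarrow> real ^ 'n::{finite,linorder}) set"
  let ?X = "hyp_space :: (real ^ 'n::{finite,linorder}) set"
  show "?I \<subseteq> carrier (BijGroup ?X)"
    by (auto simp: hyp_isometries_def)
  have "(\<lambda>x\<in>?X. x) \<in> ?I"
    by (auto simp: hyp_isometries_def BijGroup_def id_Bij)
  then show "?I \<noteq> {}" by blast
  show "inv\<^bsub>BijGroup ?X\<^esub> g \<in> ?I" if "g \<in> ?I" for g
  proof -
    have iso: "hyp_dist (g x) (g y) = hyp_dist x y" if "x \<in> ?X" "y \<in> ?X" for x y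
      using \<open>g \<in> ?I\<close> that by (auto simp: hyp_isometries_def BijGroup_def)
    have gB: "g \<in> Bij ?X"
      using \<open>g \<in> ?I\<close> by (auto simp: hyp_isometries_def BijGroup_def)
    then have im: "g ` ?X = ?X" by (auto simp: Bij_def bij_betw_def)
    have "hyp_dist (inv_into ?X g x) (inv_into ?X g y) = hyp_dist x y"
      if "x \<in> ?X" "y \<in> ?X" for x y
      using iso[of "inv_into ?X g x" "inv_into ?X g y"] that im
      by (metis f_inv_into_f inv_into_into)
    then show ?thesis
      by (auto simp: hyp_isometries_def inv_BijGroup[OF gB])
        (auto simp: BijGroup_def restrict_inv_into_Bij[OF gB])
  qed
  show "g \<otimes>\<^bsub>BijGroup ?X\<^esub> h \<in> ?I" if "g \<in> ?I" "h \<in> ?I" for g h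
  proof -
    have B: "g \<in> Bij ?X" "h \<in> Bij ?X"
      using that by (auto simp: hyp_isometries_def BijGroup_def)
    then have "h x \<in> ?X" if "x \<in> ?X" for x
      using that Bij_imp_funcset by fastforce
    moreover have "compose ?X g h \<in> Bij ?X"
      using B by (rule compose_Bij)
    ultimately show ?thesis
      using that B by (auto simp: hyp_isometries_def BijGroup_def compose_eq)
  qed
qed

end

theory Submission
  imports Defs
begin

text \<open>
  Dimension at most three. The point \<open>(z, t)\<close> of the upper half-space over the complex plane
  corresponds to the positive definite Hermitian matrix of determinant 1 with rows
  \<open>((|z|\<^sup>2 + t\<^sup>2) / t, z / t)\<close> and \<open>(cnj z / t, 1 / t)\<close>. The polar form of the determinant at two
  such matrices is twice the hyperbolic cosine of the distance of the points. The space of dimension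
  1, 2 or 3 is the set of these matrices whose off-diagonal entry lies in a real subspace \<open>V\<close> of the
  complex plane, namely \<open>{0}\<close>, \<open>\<real>\<close> or everything. The group \<open>SL(2, \<complex>)\<close> acts by
  \<open>X \<mapsto> A X A\<^sup>*\<close>, and every isometry of one of the three spaces is given by such a map, possibly
  after complex conjugation (\<open>polar_preserving_extends\<close>).

  The heart is \<open>elliptic_subgroup_fixed_point\<close>: a subgroup of \<open>SL(2, \<complex>)\<close> all of whose elements have
  fixed points has a common one. An element with a fixed point is conjugate into \<open>SU(2)\<close>, so its
  trace is real and at most 2, with trace 2 only for the identity. If all elements are scalar,
  then they act trivially. Otherwise choose a basis in which some non-scalar element is the diagonal
  matrix with entries \<open>u\<close> and \<open>cnj u\<close>. For any other element with rows \<open>(a, b)\<close> and \<open>(c, d)\<close>,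
  the traces of this element and of its product with the diagonal one are real, which forces
  \<open>d = cnj a\<close>. The commutator of the two has trace \<open>2 + 4 b c (Im u)\<^sup>2\<close>, so that \<open>b c < 0\<close> unless
  \<open>b = c = 0\<close>. Applying \<open>d = cnj a\<close> to products of two elements shows that \<open>c = - k cnj b\<close> with one
  constant \<open>k > 0\<close>, and then the whole group fixes the diagonal matrix with entries \<open>1 / sqrt k\<close>
  and \<open>sqrt k\<close>.

  Two metric facts transfer this to the group of isometries. The fixed point so obtained lies in the
  space of dimension 3, but its nearest point in the smaller space is fixed as well. If
  there are isometries that involve complex conjugation, all of them move the fixed point of the
  others to one and the same point and interchange these two points, so the midpoint is fixed by
  everything. Nearest points and midpoints are unique by \<open>polar_le_2_imp_eq\<close>: two points at which
  the polar form is at most 2 coincide.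

  Dimension at least five. An isometry of a Euclidean space of dimension 4 acts on four of the
  coordinates other than the last one, hence on hyperbolic space, and it has a fixed point there if
  and only if it has one in the Euclidean space. So it suffices to find a group of isometries of the
  quaternions in which every element has a fixed point although the whole group has none.
  An affine map \<open>x \<mapsto> p x + v\<close> has a fixed point whenever \<open>p \<noteq> 1\<close>, because \<open>1 - p\<close> is then
  invertible. Take the group generated by the multiplication by \<open>(1 + 2 i) / sqrt 5\<close>, which fixes
  only 0, and by the conjugate of the multiplication by \<open>(1 + 2 j) / sqrt 5\<close> that fixes only 1. There
  is no common fixed point. Up to a power of \<open>sqrt 5\<close>, the linear part of a nonempty reduced word is
  a product of the integral quaternions \<open>1 \<plusminus> 2 i\<close> and \<open>1 \<plusminus> 2 j\<close>, and it is not divisible by 5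
  (\<open>reduced_word_not_dvd5\<close>). It therefore differs from 1, since \<open>sqrt 5 ^ n\<close> with \<open>n > 0\<close> is no
  integer prime to 5. Every element of the group thus has a fixed point.
\<close>

section \<open>Complex two-by-two matrices\<close>

definition mat2 :: "complex \<Rightarrow> complex \<Rightarrow> complex \<Rightarrow> complex \<Rightarrow> complex^2^2" where
  "mat2 a b c d = vector [vector [a, b], vector [c, d]]"

lemma mat2_nth [simp]:
  "mat2 a b c d $ 1 $ 1 = a" "mat2 a b c d $ 1 $ 2 = b"
  "mat2 a b c d $ 2 $ 1 = c" "mat2 a b c d $ 2 $ 2 = d"
  by (simp_all add: mat2_def)

lemma mat2_cases: obtains a b c d where "A = mat2 a b c d"
proof
  show "A = mat2 (A$1$1) (A$1$2) (A$2$1) (A$2$2)"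
    by (simp add: vec_eq_iff forall_2)
qed

lemma mat2_eq_iff [simp]:
  "mat2 a b c d = mat2 a' b' c' d' \<longleftrightarrow> a = a' \<and> b = b' \<and> c = c' \<and> d = d'"
  by (metis mat2_nth)

lemma mat2_mult [simp]:
  "mat2 a b c d ** mat2 a' b' c' d' =
     mat2 (a * a' + b * c') (a * b' + b * d') (c * a' + d * c') (c * b' + d * d')"
  by (simp add: vec_eq_iff forall_2 matrix_matrix_mult_def sum_2)

lemma mat2_add [simp]: "mat2 a b c d + mat2 a' b' c' d' = mat2 (a + a') (b + b') (c + c') (d + d')"
  by (simp add: vec_eq_iff forall_2)

lemma det_mat2 [simp]: "det (mat2 a b c d) = a * d - b * c"
  by (simp add: det_2)

lemma one_mat2: "mat 1 = mat2 1 0 0 1"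
  by (simp add: vec_eq_iff forall_2 mat_def)

definition dagger :: "complex^2^2 \<Rightarrow> complex^2^2" where
  "dagger A = (\<chi> i j. cnj (A $ j $ i))"

definition conj_mat :: "complex^2^2 \<Rightarrow> complex^2^2" where
  "conj_mat A = (\<chi> i j. cnj (A $ i $ j))"

text \<open>
  The adjugate. All matrices that act below have determinant 1, for which it is the inverse; being
  polynomial in the entries, it is easier to compute with than \<^const>\<open>matrix_inv\<close>.
\<close>

definition adj2 :: "complex^2^2 \<Rightarrow> complex^2^2" where
  "adj2 A = mat2 (A$2$2) (- A$1$2) (- A$2$1) (A$1$1)"

lemma dagger_mat2 [simp]: "dagger (mat2 a b c d) = mat2 (cnj a) (cnj c) (cnj b) (cnj d)"
  by (simp add: vec_eq_iff forall_2 dagger_def)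

lemma conj_mat2 [simp]: "conj_mat (mat2 a b c d) = mat2 (cnj a) (cnj b) (cnj c) (cnj d)"
  by (simp add: vec_eq_iff forall_2 conj_mat_def)

lemma adj2_mat2 [simp]: "adj2 (mat2 a b c d) = mat2 d (- b) (- c) a"
  by (simp add: adj2_def)

lemma dagger_mult: "dagger (A ** B) = dagger B ** dagger A"
  by (rule mat2_cases[of A], rule mat2_cases[of B]) (simp add: algebra_simps)

lemma conj_mat_mult: "conj_mat (A ** B) = conj_mat A ** conj_mat B"
  by (rule mat2_cases[of A], rule mat2_cases[of B]) simp

lemma conj_mat_dagger: "conj_mat (dagger A) = dagger (conj_mat A)"
  by (rule mat2_cases[of A]) simp

lemma conj_mat_conj_mat [simp]: "conj_mat (conj_mat A) = A"
  by (rule mat2_cases[of A]) simp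

lemma det_dagger: "det (dagger A) = cnj (det A)"
  by (rule mat2_cases[of A]) (simp add: mult.commute)

lemma det_conj_mat: "det (conj_mat A) = cnj (det A)"
  by (rule mat2_cases[of A]) simp

lemma det_adj2: "det (adj2 A) = det A"
  by (rule mat2_cases[of A]) simp

lemma adj2_inverse:
  assumes "det A = 1"
  shows "adj2 A ** A = mat 1" "A ** adj2 A = mat 1"
  using assms
  by (rule_tac[!] mat2_cases[of A]) (auto simp: one_mat2 algebra_simps)

section \<open>The hyperboloid of Hermitian matrices\<close>

text \<open>
  The action of \<open>SL(2, \<complex>)\<close> on Hermitian matrices, which preserves the determinant.
\<close>

definition act :: "complex^2^2 \<Rightarrow> complex^2^2 \<Rightarrow> complex^2^2" where
  "act A X = A ** X ** dagger A"

lemma act_mult: "act (A ** B) X = act A (act B X)"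
  by (simp add: act_def dagger_mult matrix_mul_assoc)

lemma act_one [simp]: "act (mat 1) X = X"
proof -
  have "dagger (mat 1) = mat 1" by (simp add: one_mat2)
  then show ?thesis by (simp add: act_def)
qed

lemma act_adj2 [simp]:
  assumes "det A = 1"
  shows "act (adj2 A) (act A X) = X" "act A (act (adj2 A) X) = X"
  using adj2_inverse[OF assms] by (simp_all flip: act_mult)

lemma conj_mat_act: "conj_mat (act A X) = act (conj_mat A) (conj_mat X)"
  by (simp add: act_def conj_mat_mult conj_mat_dagger)

lemma det_act:
  assumes "det A = 1"
  shows "det (act A X) = det X"
  using assms by (simp add: act_def det_mul det_dagger)

definition herm :: "real \<Rightarrow> complex \<Rightarrow> real \<Rightarrow> complex^2^2" where
  "herm p w q = mat2 (of_real p) w (cnj w) (of_real q)"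

lemma herm_eq_iff [simp]: "herm p w q = herm p' w' q' \<longleftrightarrow> p = p' \<and> w = w' \<and> q = q'"
  by (auto simp: herm_def)

lemma det_herm: "det (herm p w q) = of_real (p * q - (norm w)\<^sup>2)"
  by (simp add: herm_def complex_norm_square del: of_real_power)

lemma conj_mat_herm [simp]: "conj_mat (herm p w q) = herm p (cnj w) q"
  by (simp add: herm_def)

lemma herm_add: "herm p w q + herm p' w' q' = herm (p + p') (w + w') (q + q')"
  by (simp add: herm_def)

lemma herm_iff_dagger: "(\<exists>p w q. X = herm p w q) \<longleftrightarrow> dagger X = X"
proof (rule mat2_cases[of X])
  fix a b c d assume X: "X = mat2 a b c d"
  show ?thesis
  proof
    assume "dagger X = X"
    then have *: "cnj a = a" "cnj c = b" "cnj d = d" by (auto simp: X)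
    then have "a = of_real (Re a)" "d = of_real (Re d)"
      by (simp_all add: complex_eq_iff)
    then have "X = herm (Re a) b (Re d)" using * by (auto simp: X herm_def)
    then show "\<exists>p w q. X = herm p w q" by blast
  qed (auto simp: herm_def)
qed

lemma act_herm: "\<exists>p' w' q'. act A (herm p w q) = herm p' w' q'"
proof -
  have "dagger (herm p w q) = herm p w q" using herm_iff_dagger by blast
  moreover have "dagger (dagger A) = A" by (simp add: dagger_def)
  ultimately have "dagger (act A (herm p w q)) = act A (herm p w q)"
    by (simp add: act_def dagger_mult matrix_mul_assoc)
  then show ?thesis using herm_iff_dagger by metis
qed

text \<open>
  The positive definite Hermitian matrices of determinant 1, a model of hyperbolic space of
  dimension 3.
\<close>

definition hyperboloid :: "(complex^2^2) set" where
  "hyperboloid = {herm p w q | p w q. 0 < p \<and> 0 < q \<and> p * q = 1 + (norm w)\<^sup>2}"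

text \<open>
  The polar form of the determinant. On the hyperboloid it equals twice the hyperbolic cosine of the
  distance, so it carries the whole metric; its invariance under the action comes for free from the
  multiplicativity of the determinant.
\<close>

definition polar :: "complex^2^2 \<Rightarrow> complex^2^2 \<Rightarrow> real" where
  "polar X Y = Re (det (X + Y) - det X - det Y)"

lemma matrix_add_rdistrib:
  fixes A :: "'a::semiring_1^'n^'m" shows "(A + B) ** C = A ** C + B ** C"
  by (vector matrix_matrix_mult_def sum.distrib[symmetric] distrib_right)

lemma act_add: "act A (X + Y) = act A X + act A Y"
  by (simp add: act_def matrix_add_ldistrib matrix_add_rdistrib)

lemma polar_act: "det A = 1 \<Longrightarrow> polar (act A X) (act A Y) = polar X Y"
  by (simp add: polar_def det_act flip: act_add)

lemma polar_herm: "polar (herm p w q) (herm p' w' q') = p * q' + p' * q - 2 * (w \<bullet> w')"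
  by (simp add: polar_def det_herm herm_add power2_norm_eq_inner algebra_simps inner_commute
      flip: of_real_diff)

lemma hyperboloid_iff:
  "herm p w q \<in> hyperboloid \<longleftrightarrow> 0 < q \<and> p * q = 1 + (norm w)\<^sup>2"
proof -
  have "0 < p" if "0 < q" "p * q = 1 + (norm w)\<^sup>2"
  proof -
    have "0 < p * q" using that by (simp add: add_pos_nonneg)
    with \<open>0 < q\<close> show ?thesis using zero_less_mult_pos2 by blast
  qed
  then show ?thesis by (auto simp: hyperboloid_def)
qed

lemma hyperboloid_cases:
  assumes "X \<in> hyperboloid"
  obtains p w q where "X = herm p w q" "0 < p" "0 < q" "p * q = 1 + (norm w)\<^sup>2"
  using assms by (auto simp: hyperboloid_def)

text \<open>
  Determinant 1 is clearly preserved. Positivity of the lower right entry \<open>q'\<close> of the image follows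
  by completing the square: \<open>p q' = |c p + d cnj w|\<^sup>2 + |d|\<^sup>2\<close>.
\<close>

lemma act_hyperboloid_iff:
  assumes "det A = 1"
  shows "act A X \<in> hyperboloid \<longleftrightarrow> X \<in> hyperboloid"
proof -
  have *: "act A X \<in> hyperboloid" if X: "X \<in> hyperboloid" and A: "det A = 1" for A X
  proof -
    obtain p w q where pwq: "X = herm p w q" "0 < p" "0 < q" "p * q = 1 + (norm w)\<^sup>2"
      using X by (rule hyperboloid_cases)
    obtain p' w' q' where X': "act A X = herm p' w' q'" using act_herm pwq by metis
    obtain a b c d where Aeq: "A = mat2 a b c d" by (rule mat2_cases)
    have "det X = 1" by (simp add: pwq det_herm)
    then have "det (herm p' w' q') = 1" using det_act[OF A, of X] X' by simp
    then have d: "p' * q' = 1 + (norm w')\<^sup>2"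
      unfolding det_herm using of_real_eq_1_iff by (smt (verit))
    have wq: "w * cnj w = of_real (p * q - 1)"
      using pwq by (simp flip: complex_norm_square)
    have "of_real q' = c * p * cnj c + d * cnj w * cnj c + c * w * cnj d + d * q * cnj d"
      using X' by (simp add: pwq(1) act_def herm_def Aeq algebra_simps)
    then have "of_real (p * q') = p * (c * p * cnj c + d * cnj w * cnj c + c * w * cnj d + d * q * cnj d)"
      by simp
    also have "\<dots> = (c * p + d * cnj w) * cnj (c * p + d * cnj w) + d * cnj d"
    proof -
      have "d * cnj d * (p * q) = d * cnj d * (1 + w * cnj w)"
        using wq by simp
      then show ?thesis by (simp add: algebra_simps)
    qed
    also have "\<dots> = of_real ((norm (c * p + d * cnj w))\<^sup>2 + (norm d)\<^sup>2)"
      by (simp add: complex_norm_square del: of_real_power)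
    finally have e: "p * q' = (norm (c * p + d * cnj w))\<^sup>2 + (norm d)\<^sup>2"
      using of_real_eq_iff by blast
    have "c \<noteq> 0 \<or> d \<noteq> 0" using A Aeq by auto
    then have "0 < p * q'"
      unfolding e using pwq(2) by (cases "d = 0") (auto intro: add_nonneg_pos)
    then have "0 < q'" using pwq(2) by (simp add: zero_less_mult_iff)
    then show ?thesis using d by (simp add: X' hyperboloid_iff)
  qed
  show ?thesis using *[OF _ assms] *[of "act A X" "adj2 A"] assms by (auto simp: det_adj2)
qed

section \<open>Isometries as fractional linear maps\<close>

text \<open>
  In the half-space model: an upper triangular matrix translates the point \<open>(z, t)\<close> to \<open>(0, t)\<close> and
  then scales it to \<open>(0, 1)\<close>, the point represented by the identity matrix.
\<close>

lemma hyperboloid_transitive: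
  assumes "X \<in> hyperboloid"
  shows "\<exists>C. det C = 1 \<and> act C X = herm 1 0 1"
proof -
  obtain p w q where X: "X = herm p w q" "0 < p" "0 < q" "p * q = 1 + (norm w)\<^sup>2"
    using assms by (rule hyperboloid_cases)
  define t where "t = complex_of_real (sqrt q)"
  have t: "t \<noteq> 0" "cnj t = t" "complex_of_real q = t * t"
    using X(3) by (simp_all add: t_def flip: of_real_mult)
  have wq: "p * (t * t) = 1 + w * cnj w"
    using X(4) by (simp flip: complex_norm_square t(3) of_real_mult)
  define C where "C = mat2 t (- w / t) 0 (1 / t)"
  have "C ** X = mat2 (1 / t) 0 (cnj w / t) t"
    using t wq by (simp add: C_def X(1) herm_def field_simps)
  then have "act C X = herm 1 0 1"
    using t by (simp add: act_def C_def herm_def field_simps)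
  moreover have "det C = 1" using t by (simp add: C_def)
  ultimately show ?thesis by blast
qed

text \<open>
  The matrix with rows \<open>(\<sigma>, w)\<close> and \<open>(cnj w, - \<sigma>)\<close> has the eigenvalue \<open>r\<close>, and \<open>(r + \<sigma>, cnj w)\<close> is an
  eigenvector unless it vanishes. Its normalization is \<open>(S, cnj W)\<close>; the second equation expresses
  that the orthogonal vector \<open>(- W, S)\<close> belongs to the eigenvalue \<open>- r\<close>.
\<close>

lemma traceless_herm_eigenvector:
  fixes \<sigma> :: real and w :: complex
  defines "r \<equiv> sqrt (\<sigma>\<^sup>2 + (norm w)\<^sup>2)"
  shows "\<exists>(S::real) (W::complex). S\<^sup>2 + (norm W)\<^sup>2 = 1 \<and> of_real \<sigma> * of_real S + w * cnj W = of_real r * of_real S \<and>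
    w * of_real S - of_real \<sigma> * W = of_real r * W"
proof (cases "r + \<sigma> = 0")
  case True
  have "r\<^sup>2 = \<sigma>\<^sup>2 + (norm w)\<^sup>2" by (simp add: r_def)
  moreover have "r\<^sup>2 = \<sigma>\<^sup>2"
    using True by (metis add_eq_0_iff power2_minus)
  ultimately have "w = 0" by simp
  then show ?thesis
    using True
    by (intro exI[of _ 0] exI[of _ 1]) (auto simp: add_eq_0_iff2)
next
  case False
  define s where "s = r + \<sigma>"
  define n where "n = sqrt (s\<^sup>2 + (norm w)\<^sup>2)"
  have "0 < s\<^sup>2 + (norm w)\<^sup>2" using False by (simp add: s_def add_pos_nonneg)
  then have n: "n > 0" "n\<^sup>2 = s\<^sup>2 + (norm w)\<^sup>2" by (simp_all add: n_def)
  have r2: "(norm w)\<^sup>2 = r\<^sup>2 - \<sigma>\<^sup>2" by (simp add: r_def)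
  have ww: "w * cnj w = of_real (r\<^sup>2 - \<sigma>\<^sup>2)"
    by (simp only: r2 flip: complex_norm_square)
  show ?thesis
  proof (intro exI conjI)
    have "(s / n)\<^sup>2 + (norm (w / of_real n))\<^sup>2 = (s\<^sup>2 + (norm w)\<^sup>2) / n\<^sup>2"
      using n(1) by (simp add: norm_divide power_divide add_divide_distrib)
    then show "(s / n)\<^sup>2 + (norm (w / of_real n))\<^sup>2 = 1" unfolding n(2)[symmetric] using n(1) by simp
    have "of_real \<sigma> * of_real s + w * cnj w = complex_of_real (r * s)"
      unfolding ww by (simp add: s_def power2_eq_square algebra_simps flip: of_real_mult of_real_add of_real_diff)
    then show "\<sigma> * complex_of_real (s / n) + w * cnj (w / of_real n) = r * complex_of_real (s / n)"
      using n(1) by (simp add: field_simps)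
    show "w * complex_of_real (s / n) - \<sigma> * (w / of_real n) = r * (w / of_real n)"
      using n(1) by (simp add: field_simps s_def)
  qed
qed

text \<open>
  The unitary matrix whose rows are the conjugates of the two eigenvectors diagonalizes every matrix
  \<open>c + k N\<close>, where \<open>N\<close> is the traceless Hermitian matrix given by \<open>\<sigma>\<close> and \<open>w\<close>. Two choices of
  \<open>c\<close> and \<open>k\<close> matter: real ones give Hermitian matrices, so that points can be rotated about the base
  point; \<open>c\<close> real and \<open>k\<close> imaginary give the elements of \<open>SU(2)\<close>.
\<close>

lemma unitary_diagonalization:
  fixes \<sigma> :: real and w :: complex
  defines "r \<equiv> sqrt (\<sigma>\<^sup>2 + (norm w)\<^sup>2)"
  shows "\<exists>B. det B = 1 \<and> dagger B = adj2 B \<and>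
    (\<forall>(c::complex) (k::complex). B ** mat2 (c + k * \<sigma>) (k * w) (k * cnj w) (c - k * \<sigma>) ** adj2 B
       = mat2 (c + k * r) 0 0 (c - k * r))"
proof -
  obtain S :: real and W :: complex where SW: "S\<^sup>2 + (norm W)\<^sup>2 = 1"
    and 1: "of_real \<sigma> * of_real S + w * cnj W = of_real r * of_real S"
    and 2: "w * of_real S - of_real \<sigma> * W = of_real r * W"
    using traceless_herm_eigenvector[of \<sigma> w] unfolding r_def by blast
  have 3: "of_real \<sigma> * of_real S + cnj w * W = of_real r * of_real S" using arg_cong[OF 1, of cnj] by simp
  have 4: "cnj w * of_real S - of_real \<sigma> * cnj W = of_real r * cnj W" using arg_cong[OF 2, of cnj] by simp
  have "complex_of_real (S\<^sup>2) + of_real ((norm W)\<^sup>2) = 1"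
    using SW by (metis of_real_1 of_real_add)
  then have SW': "complex_of_real S * S + W * cnj W = 1"
    by (simp only: complex_norm_square) (simp add: power2_eq_square)
  define B where "B = mat2 S W (- cnj W) S"
  have unitary_mult: "mat2 s w (- v) s ** mat2 (x * s) (- y * w) (x * v) (y * s) =
      mat2 (x * (s * s + w * v)) 0 0 (y * (s * s + w * v))" for s w v x y
    by (simp add: algebra_simps)
  have "B ** mat2 (c + k * \<sigma>) (k * w) (k * cnj w) (c - k * \<sigma>) ** adj2 B
       = mat2 (c + k * r) 0 0 (c - k * r)" for c k :: complex
  proof -
    have "(c + k * \<sigma>) * S + k * w * cnj W = (c + k * r) * S"
      using arg_cong[OF 1, of "(*) k"] by (simp add: algebra_simps)
    moreover have "- ((c + k * \<sigma>) * W) + k * w * S = - (c - k * r) * W"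
      using arg_cong[OF 2, of "(*) k"] by (simp add: algebra_simps)
    moreover have "k * cnj w * S + (c - k * \<sigma>) * cnj W = (c + k * r) * cnj W"
      using arg_cong[OF 4, of "(*) k"] by (simp add: algebra_simps)
    moreover have "- (k * cnj w * W) + (c - k * \<sigma>) * S = (c - k * r) * S"
      using arg_cong[OF 3, of "(*) k"] by (simp add: algebra_simps)
    ultimately have "mat2 (c + k * \<sigma>) (k * w) (k * cnj w) (c - k * \<sigma>) ** adj2 B =
      mat2 ((c + k * r) * S) (- (c - k * r) * W) ((c + k * r) * cnj W) ((c - k * r) * S)"
      by (simp add: B_def)
    then have "B ** (mat2 (c + k * \<sigma>) (k * w) (k * cnj w) (c - k * \<sigma>) ** adj2 B) =
       mat2 ((c + k * r) * (complex_of_real S * S + W * cnj W)) 0 0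
         ((c - k * r) * (complex_of_real S * S + W * cnj W))"
      unfolding B_def by (simp only: unitary_mult)
    then show ?thesis by (simp add: SW' matrix_mul_assoc)
  qed
  moreover have "det B = 1" using SW' by (simp add: B_def)
  moreover have "dagger B = adj2 B" by (simp add: B_def)
  ultimately show ?thesis by blast
qed

text \<open>
  Isometric embeddings of a part of the hyperboloid into the hyperboloid.
\<close>

definition polar_preserving :: "(complex^2^2) set \<Rightarrow> (complex^2^2 \<Rightarrow> complex^2^2) \<Rightarrow> bool" where
  "polar_preserving D f \<longleftrightarrow>
     (\<forall>X\<in>D. f X \<in> hyperboloid) \<and> (\<forall>X\<in>D. \<forall>Y\<in>D. polar (f X) (f Y) = polar X Y)"

lemma polar_preserving_act:
  assumes "polar_preserving D f" "det A = 1"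
  shows "polar_preserving D (\<lambda>X. act A (f X))"
  using assms by (simp add: polar_preserving_def act_hyperboloid_iff polar_act)

text \<open>
  After the base point has been moved to \<open>herm 1 0 1\<close> by transitivity, the image of \<open>herm 2 0 (1/2)\<close> has
  the right distance from it, and a rotation about the base point brings it to its place.
\<close>

lemma align_base_point:
  assumes f: "polar_preserving D f" and D: "D \<subseteq> hyperboloid"
    and e: "herm 1 0 1 \<in> D" "herm 2 0 (1/2) \<in> D"
  shows "\<exists>A. det A = 1 \<and> act A (f (herm 1 0 1)) = herm 1 0 1 \<and>
             act A (f (herm 2 0 (1/2))) = herm 2 0 (1/2)"
proof -
  obtain C where C: "det C = 1" "act C (f (herm 1 0 1)) = herm 1 0 1"
    using hyperboloid_transitive f e unfolding polar_preserving_def by blast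
  have g: "polar_preserving D (\<lambda>X. act C (f X))" using f C(1) by (rule polar_preserving_act)
  then obtain p w q where X: "act C (f (herm 2 0 (1/2))) = herm p w q" "p * q = 1 + (norm w)\<^sup>2"
    using e unfolding polar_preserving_def by (metis hyperboloid_cases)
  have "polar (herm p w q) (herm 1 0 1) = polar (herm 2 0 (1/2)) (herm 1 0 1)"
    using g e X C unfolding polar_preserving_def by metis
  then have pq: "p + q = 5 / 2" by (simp add: polar_herm)
  \<comment> \<open>The image is 5/4 times the identity plus a traceless Hermitian matrix, whose eigenvalues turn out
    to be 3/4 and - 3/4 as for the matrix herm 2 0 (1/2).\<close>
  define \<sigma> where "\<sigma> = (p - q) / 2"
  have p: "p = 5 / 4 + \<sigma>" and q: "q = 5 / 4 - \<sigma>" using pq by (simp_all add: \<sigma>_def field_simps)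
  have "\<sigma>\<^sup>2 + (norm w)\<^sup>2 = (3 / 4)\<^sup>2"
    using X(2) unfolding p q by (simp add: field_simps power2_eq_square)
  then have r: "sqrt (\<sigma>\<^sup>2 + (norm w)\<^sup>2) = 3 / 4" by simp
  obtain B where B: "det B = 1" "dagger B = adj2 B"
    "\<And>(c::complex) (k::complex). B ** mat2 (c + k * \<sigma>) (k * w) (k * cnj w) (c - k * \<sigma>) ** adj2 B
       = mat2 (c + k * complex_of_real (3 / 4)) 0 0 (c - k * complex_of_real (3 / 4))"
    using unitary_diagonalization[of \<sigma> w] unfolding r by blast
  have "act B (herm 1 0 1) = herm 1 0 1"
    using B(3)[of 1 0] by (simp add: act_def B(2) herm_def)
  moreover have "act B (herm p w q) = herm 2 0 (1/2)"
    using B(3)[of "5/4" 1] by (simp add: act_def B(2) herm_def p q)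
  ultimately show ?thesis
    using C B(1) X(1) by (intro exI[of _ "B ** C"]) (simp add: act_mult det_mul)
qed

text \<open>
  The polar forms with the two fixed points determine both diagonal entries, and the determinant then
  gives the modulus of the off-diagonal entry: the map rotates or reflects about the axis.
\<close>

lemma polar_preserving_fixing_axis:
  assumes f: "polar_preserving D f" and D: "D \<subseteq> hyperboloid"
    and e: "herm 1 0 1 \<in> D" "herm 2 0 (1/2) \<in> D"
    and fix_axis: "f (herm 1 0 1) = herm 1 0 1" "f (herm 2 0 (1/2)) = herm 2 0 (1/2)"
    and X: "herm p w q \<in> D"
  shows "\<exists>w'. f (herm p w q) = herm p w' q \<and> norm w' = norm w"
proof -
  have "f (herm p w q) \<in> hyperboloid" using f X unfolding polar_preserving_def by blast
  then obtain p' w' q' where X': "f (herm p w q) = herm p' w' q'" "p' * q' = 1 + (norm w')\<^sup>2"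
    by (rule hyperboloid_cases)
  have "polar (herm p' w' q') (herm 1 0 1) = polar (herm p w q) (herm 1 0 1)"
    "polar (herm p' w' q') (herm 2 0 (1/2)) = polar (herm p w q) (herm 2 0 (1/2))"
    using f X X' e fix_axis unfolding polar_preserving_def by metis+
  then have pq: "p' = p" "q' = q" by (simp_all add: polar_herm)
  have "p * q = 1 + (norm w)\<^sup>2" using X D hyperboloid_iff by blast
  then have "(norm w')\<^sup>2 = (norm w)\<^sup>2" using X'(2) by (simp add: pq)
  then show ?thesis using X'(1) by (simp add: pq)
qed

text \<open>
  The map is corrected until it fixes four points in general position, or as many of them as the
  set \<open>D\<close> contains. The disjunction covers the three dimensions: \<open>D\<close> lies on the axis, or it
  lies in the real plane and contains a point off the axis, or it contains a
  point off the real plane too. The polar forms with the fixed points determine every point. Only the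
  sign of the imaginary part of the off-diagonal entry remains open until the last of the four
  points, whence the complex conjugation.
\<close>

theorem polar_preserving_extends:
  assumes f: "polar_preserving D f" and D: "D \<subseteq> hyperboloid"
    and e: "herm 1 0 1 \<in> D" "herm 2 0 (1/2) \<in> D"
    and flag: "D \<subseteq> {X. X $ 1 $ 2 = 0} \<or>
       herm 2 1 1 \<in> D \<and> (D \<subseteq> {X. X $ 1 $ 2 \<in> \<real>} \<or> herm 2 \<i> 1 \<in> D)"
  shows "\<exists>A. det A = 1 \<and> ((\<forall>X\<in>D. f X = act A X) \<or> (\<forall>X\<in>D. f X = act A (conj_mat X)))"
proof -
  obtain C where C: "det C = 1" "act C (f (herm 1 0 1)) = herm 1 0 1"
      "act C (f (herm 2 0 (1/2))) = herm 2 0 (1/2)"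
    using align_base_point[OF f D e] by blast
  have herm_D: "\<exists>p w q. X = herm p w q" if "X \<in> D" for X
    using that D unfolding hyperboloid_def by blast
  show ?thesis
  proof (cases "D \<subseteq> {X. X $ 1 $ 2 = 0}")
    case True
    define g where "g = (\<lambda>X. act C (f X))"
    have g: "polar_preserving D g" unfolding g_def using f C(1) by (rule polar_preserving_act)
    have "g X = X" if "X \<in> D" for X
    proof -
      obtain p w q where X: "X = herm p w q" using herm_D \<open>X \<in> D\<close> by blast
      have "w = 0" using True that X by (auto simp: herm_def)
      then show ?thesis
        using polar_preserving_fixing_axis[OF g D e, of p w q] C that X by (auto simp: g_def)
    qed
    moreover have "f X = act (adj2 C) (g X)" for X
      using act_adj2(1)[OF C(1)] by (simp add: g_def)
    ultimately show ?thesis using C(1) by (intro exI[of _ "adj2 C"]) (simp add: det_adj2)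
  next
    case False
    then have e2: "herm 2 1 1 \<in> D" and flag': "D \<subseteq> {X. X $ 1 $ 2 \<in> \<real>} \<or> herm 2 \<i> 1 \<in> D"
      using flag by auto
    have g: "polar_preserving D (\<lambda>X. act C (f X))" using f C(1) by (rule polar_preserving_act)
    obtain \<omega> where \<omega>: "act C (f (herm 2 1 1)) = herm 2 \<omega> 1" "norm \<omega> = 1"
      using polar_preserving_fixing_axis[OF g D e _ _ e2] C by auto
    \<comment> \<open>The diagonal matrix with entries s and cnj s multiplies the off-diagonal entry by the square of s,
      which has to cancel the angle \<omega>.\<close>
    define s where "s = csqrt (cnj \<omega>)"
    have s2: "s * s = cnj \<omega>" by (simp add: s_def flip: power2_eq_square)
    then have "norm s * norm s = 1" using \<omega>(2) by (metis norm_mult complex_mod_cnj)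
    then have "(norm s)\<^sup>2 = 1" by (simp add: power2_eq_square)
    then have scs: "s * cnj s = 1" by (metis complex_norm_square of_real_1)
    define R where "R = mat2 s 0 0 (cnj s)"
    have R: "det R = 1" "act R (herm p w q) = herm p (cnj \<omega> * w) q" for p w q
    proof -
      have "s * complex_of_real p * cnj s = (s * cnj s) * p" "cnj s * complex_of_real q * s = (s * cnj s) * q"
        "s * w * s = (s * s) * w" "cnj s * cnj w * cnj s = cnj (s * s) * cnj w" by simp_all
      then show "act R (herm p w q) = herm p (cnj \<omega> * w) q"
        unfolding scs s2 by (simp add: R_def act_def herm_def)
      show "det R = 1" using scs by (simp add: R_def)
    qed
    define g where "g = (\<lambda>X. act (R ** C) (f X))"
    have detRC: "det (R ** C) = 1" using R C by (simp add: det_mul)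
    have g: "polar_preserving D g" unfolding g_def using f detRC by (rule polar_preserving_act)
    have "cnj \<omega> * \<omega> = 1" using \<omega>(2) complex_norm_square[of \<omega>] by (simp add: mult.commute)
    then have ge: "g (herm 1 0 1) = herm 1 0 1" "g (herm 2 0 (1/2)) = herm 2 0 (1/2)"
        "g (herm 2 1 1) = herm 2 1 1"
      using C \<omega> R by (simp_all add: g_def act_mult)
    have gX: "\<exists>w'. g (herm p w q) = herm p w' q \<and> norm w' = norm w \<and> Re w' = Re w"
      if X: "herm p w q \<in> D" for p w q
    proof -
      obtain w' where w': "g (herm p w q) = herm p w' q" "norm w' = norm w"
        using polar_preserving_fixing_axis[OF g D e ge(1,2) X] by blast
      have "polar (herm p w' q) (herm 2 1 1) = polar (herm p w q) (herm 2 1 1)"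
        using g X w' e2 ge(3) unfolding polar_preserving_def by metis
      then have "Re w' = Re w" by (simp add: polar_herm inner_complex_def)
      then show ?thesis using w' by blast
    qed
    have Im2: "(Im w')\<^sup>2 = (Im w)\<^sup>2" if "norm w' = norm w" "Re w' = Re w" for w w'
      using cmod_power2[of w] cmod_power2[of w'] unfolding that by linarith
    have "(\<forall>X\<in>D. g X = X) \<or> (\<forall>X\<in>D. g X = conj_mat X)"
    proof (cases "herm 2 \<i> 1 \<in> D")
      case False
      then have "g X = X" if "X \<in> D" for X
      proof -
        obtain p w q where X: "X = herm p w q" using herm_D \<open>X \<in> D\<close> by blast
        have "w \<in> \<real>" using flag' that X False by (auto simp: herm_def)
        moreover obtain w' where "g X = herm p w' q" "norm w' = norm w" "Re w' = Re w"
          using gX \<open>X \<in> D\<close> X by blast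
        ultimately show ?thesis using Im2[of w' w] X by (simp add: complex_is_Real_iff complex_eq_iff)
      qed
      then show ?thesis by blast
    next
      case True
      then obtain v where v: "g (herm 2 \<i> 1) = herm 2 v 1" "norm v = 1" "Re v = 0"
        using gX[OF True] by auto
      have v2: "(Im v)\<^sup>2 = 1" using Im2[of v \<i>] v by simp
      have Im_v: "Im w' * Im v = Im w" if "herm p w q \<in> D" "g (herm p w q) = herm p w' q" for p w q w'
      proof -
        have "polar (herm p w' q) (herm 2 v 1) = polar (herm p w q) (herm 2 \<i> 1)"
          using g that v True unfolding polar_preserving_def by metis
        then show ?thesis using v by (simp add: polar_herm inner_complex_def)
      qed
      from v2 have "Im v = 1 \<or> Im v = - 1" by (simp add: power2_eq_1_iff)
      then show ?thesis
      proof
        assume "Im v = 1"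
        have "g X = X" if "X \<in> D" for X
        proof -
          obtain p w q where X: "X = herm p w q" using herm_D \<open>X \<in> D\<close> by blast
          then obtain w' where w': "g X = herm p w' q" "Re w' = Re w" using gX \<open>X \<in> D\<close> by blast
          then have "Im w' * Im v = Im w" using Im_v that X by blast
          then show ?thesis using w' \<open>Im v = 1\<close> X by (simp add: complex_eq_iff)
        qed
        then show ?thesis by blast
      next
        assume "Im v = - 1"
        have "g X = conj_mat X" if "X \<in> D" for X
        proof -
          obtain p w q where X: "X = herm p w q" using herm_D \<open>X \<in> D\<close> by blast
          then obtain w' where w': "g X = herm p w' q" "Re w' = Re w" using gX \<open>X \<in> D\<close> by blast
          then have "Im w' * Im v = Im w" using Im_v that X by blast
          then show ?thesis using w' \<open>Im v = - 1\<close> X by (simp add: complex_eq_iff)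
        qed
        then show ?thesis by blast
      qed
    qed
    moreover have "f X = act (adj2 (R ** C)) (g X)" for X
      using act_adj2(1)[OF detRC] by (simp add: g_def)
    ultimately show ?thesis
      using detRC by (intro exI[of _ "adj2 (R ** C)"]) (auto simp: det_adj2)
  qed
qed

section \<open>Subgroups of elliptic elements\<close>

lemma trace_mat2 [simp]: "trace (mat2 a b c d) = a + d"
  by (simp add: trace_def sum_2)

lemma trace_conjugate:
  assumes "det C = 1" shows "trace (C ** A ** adj2 C) = trace A"
proof -
  have "trace (C ** A ** adj2 C) = trace (adj2 C ** (C ** A))" by (rule trace_mul_sym)
  then show ?thesis by (simp add: matrix_mul_assoc adj2_inverse[OF assms])
qed

text \<open>
  The usual parametrization of \<open>SU(2)\<close>.
\<close>

lemma SU2_form: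
  assumes "det U = 1" "dagger U = adj2 U"
  obtains a b where "U = mat2 a b (- cnj b) (cnj a)" "(norm a)\<^sup>2 + (norm b)\<^sup>2 = 1"
proof -
  obtain a b c d where U: "U = mat2 a b c d" by (rule mat2_cases)
  have cd: "d = cnj a" "c = - cnj b" using assms(2) by (auto simp: U)
  have "a * cnj a + b * cnj b = 1" using assms(1) by (simp add: U cd)
  then have "complex_of_real ((norm a)\<^sup>2 + (norm b)\<^sup>2) = of_real 1"
    by (simp only: of_real_add complex_norm_square of_real_1)
  then have "(norm a)\<^sup>2 + (norm b)\<^sup>2 = 1" by (simp only: of_real_eq_iff)
  with that U cd show thesis by blast
qed

text \<open>
  Move the fixed point to the identity matrix, whose stabilizer consists of the unitary matrices.
\<close>

lemma elliptic_conj_SU2: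
  assumes A: "det A = 1" and X: "X \<in> hyperboloid" "act A X = X"
  shows "\<exists>C. det C = 1 \<and> dagger (C ** A ** adj2 C) = adj2 (C ** A ** adj2 C)"
proof -
  obtain C where C: "det C = 1" "act C X = herm 1 0 1" using hyperboloid_transitive[OF X(1)] by blast
  define U where "U = C ** A ** adj2 C"
  have detU: "det U = 1" by (simp add: U_def det_mul det_adj2 C A)
  have "act U (herm 1 0 1) = herm 1 0 1"
    using C X(2) by (simp add: U_def act_mult flip: C(2))
  then have "U ** dagger U = mat 1" by (simp add: act_def herm_def flip: one_mat2)
  then have "adj2 U ** (U ** dagger U) = adj2 U" by simp
  then have "dagger U = adj2 U" by (simp add: matrix_mul_assoc adj2_inverse[OF detU])
  then show ?thesis using C(1) U_def by blast
qed

lemma conjugate_cancel: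
  assumes "det C = 1" shows "adj2 C ** (C ** A ** adj2 C) ** C = A"
proof -
  have "adj2 C ** (C ** A ** adj2 C) ** C = (adj2 C ** C) ** A ** (adj2 C ** C)"
    by (simp add: matrix_mul_assoc)
  then show ?thesis by (simp add: adj2_inverse[OF assms])
qed

text \<open>
  The trace is invariant under conjugation, and in \<open>SU(2)\<close> it is twice the real part of an entry of
  modulus at most 1.
\<close>

lemma elliptic_trace:
  assumes A: "det A = 1" and X: "X \<in> hyperboloid" "act A X = X"
  shows "Im (trace A) = 0" "Re (trace A) \<le> 2" "Re (trace A) = 2 \<Longrightarrow> A = mat 1"
proof -
  obtain C where C: "det C = 1" "dagger (C ** A ** adj2 C) = adj2 (C ** A ** adj2 C)"
    using elliptic_conj_SU2[OF assms] by blast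
  have "det (C ** A ** adj2 C) = 1" by (simp add: det_mul det_adj2 C A)
  then obtain a b where U: "C ** A ** adj2 C = mat2 a b (- cnj b) (cnj a)"
     and ab: "(norm a)\<^sup>2 + (norm b)\<^sup>2 = 1"
    using C(2) by (rule SU2_form)
  have tr: "trace A = a + cnj a" using trace_conjugate[OF C(1), of A] U by simp
  show "Im (trace A) = 0" by (simp add: tr)
  have ab': "(Re a)\<^sup>2 + (Im a)\<^sup>2 + (norm b)\<^sup>2 = 1" using ab by (simp add: cmod_power2)
  have "(Re a)\<^sup>2 \<le> 1" using ab' zero_le_power2[of "Im a"] zero_le_power2[of "norm b"] by linarith
  then have "Re a \<le> 1" by (simp add: abs_square_le_1)
  then show "Re (trace A) \<le> 2" by (simp add: tr)
  assume "Re (trace A) = 2"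
  then have a1: "Re a = 1" by (simp add: tr)
  then have "(Im a)\<^sup>2 + (norm b)\<^sup>2 = 0" using ab' by simp
  then have "Im a = 0" "b = 0" by (simp_all add: sum_power2_eq_zero_iff)
  then have "C ** A ** adj2 C = mat 1" using U a1 by (simp add: one_mat2 complex_eq_iff)
  then show "A = mat 1" using conjugate_cancel[OF C(1), of A] by (simp add: adj2_inverse[OF C(1)])
qed

definition elliptic_subgroup :: "(complex^2^2) set \<Rightarrow> bool" where
  "elliptic_subgroup G \<longleftrightarrow>
     (\<forall>A\<in>G. det A = 1 \<and> adj2 A \<in> G \<and> (\<exists>X\<in>hyperboloid. act A X = X)) \<and>
     (\<forall>A\<in>G. \<forall>B\<in>G. A ** B \<in> G)"

lemma elliptic_subgroup_conjugate:
  assumes G: "elliptic_subgroup G" and M: "det M = 1"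
  shows "elliptic_subgroup ((\<lambda>A. M ** A ** adj2 M) ` G)" (is "elliptic_subgroup (?c ` G)")
proof -
  have cm: "?c A ** ?c B = ?c (A ** B)" for A B
  proof -
    have "?c A ** ?c B = M ** A ** (adj2 M ** M) ** B ** adj2 M" by (simp add: matrix_mul_assoc)
    then show ?thesis by (simp add: adj2_inverse[OF M] matrix_mul_assoc)
  qed
  have ca: "adj2 (?c A) = ?c (adj2 A)" for A
    by (rule mat2_cases[of A], rule mat2_cases[of M]) (simp add: algebra_simps)
  have cf: "act (?c A) (act M X) = act M X" if "act A X = X" for A X
    using that by (simp add: act_mult M)
  show ?thesis
    unfolding elliptic_subgroup_def
  proof (intro conjI ballI)
    fix A' assume "A' \<in> ?c ` G"
    then obtain A where A: "A \<in> G" "A' = ?c A" by blast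
    show "det A' = 1" using A G M by (simp add: elliptic_subgroup_def det_mul det_adj2)
    show "adj2 A' \<in> ?c ` G" using A G by (auto simp: elliptic_subgroup_def ca)
    obtain X where "X \<in> hyperboloid" "act A X = X" using A G by (auto simp: elliptic_subgroup_def)
    then show "\<exists>X\<in>hyperboloid. act A' X = X"
      using cf A(2) act_hyperboloid_iff[OF M] by blast
  next
    fix A' B' assume "A' \<in> ?c ` G" "B' \<in> ?c ` G"
    then show "A' ** B' \<in> ?c ` G" using G by (auto simp: cm elliptic_subgroup_def)
  qed
qed

lemma elliptic_subgroup_trace:
  assumes "elliptic_subgroup G" "A \<in> G"
  shows "Im (trace A) = 0" "Re (trace A) \<le> 2" "Re (trace A) = 2 \<Longrightarrow> A = mat 1"
  using assms elliptic_trace[of A] unfolding elliptic_subgroup_def by blast+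

text \<open>
  Reality of the traces of \<open>h\<close> and \<open>g h\<close> amounts to two linear equations for the real and imaginary
  parts of \<open>a\<close> and \<open>d\<close>. The second claim comes from the commutator of \<open>g\<close> and \<open>h\<close>: with
  \<open>m = |a|\<^sup>2 - 1 = b c\<close> its trace is \<open>2 + 4 m (Im u)\<^sup>2\<close>, so \<open>m \<le> 0\<close>; and if \<open>m = 0\<close>, then the commutator
  is the identity, so that \<open>h\<close> commutes with \<open>g\<close> and is diagonal.
\<close>

lemma elliptic_subgroup_with_diagonal:
  assumes G: "elliptic_subgroup G" and g: "mat2 u 0 0 (cnj u) \<in> G"
    and u: "u * cnj u = 1" "Im u \<noteq> 0" and h: "mat2 a b c d \<in> G"
  shows "d = cnj a" "b \<noteq> 0 \<or> c \<noteq> 0 \<Longrightarrow> Im (b * c) = 0 \<and> Re (b * c) < 0"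
proof -
  let ?g = "mat2 u 0 0 (cnj u)" and ?h = "mat2 a b c d"
  have mult: "A ** B \<in> G" if "A \<in> G" "B \<in> G" for A B
    using G that by (auto simp: elliptic_subgroup_def)
  have adj: "adj2 A \<in> G" if "A \<in> G" for A
    using G that by (auto simp: elliptic_subgroup_def)
  have 1: "Im a + Im d = 0" using elliptic_subgroup_trace(1)[OF G h] by simp
  have "Im (u * a + cnj u * d) = 0"
    using elliptic_subgroup_trace(1)[OF G mult[OF g h]] by simp
  then have "Re u * (Im a + Im d) + Im u * (Re a - Re d) = 0" by (simp add: algebra_simps)
  then have "Re a = Re d" using 1 u(2) by simp
  then show d: "d = cnj a" using 1 by (simp add: complex_eq_iff)
  define m where "m = (norm a)\<^sup>2 - 1"
  have "det ?h = 1" using G h by (auto simp: elliptic_subgroup_def)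
  then have "b * c = a * cnj a - 1" by (simp add: d algebra_simps)
  then have bc: "b * c = of_real m" unfolding m_def of_real_diff complex_norm_square by simp
  have det: "a * cnj a = 1 + of_real m" by (simp add: m_def flip: complex_norm_square)
  define K where "K = ?g ** ?h ** (adj2 ?g ** adj2 ?h)"
  have K: "K \<in> G" unfolding K_def by (intro mult adj g h)
  have K_eq: "K = mat2 (u * cnj u * (a * cnj a) - u * u * (b * c)) (a * b * (u * u - u * cnj u))
        (c * cnj a * (cnj u * cnj u - u * cnj u)) (u * cnj u * (a * cnj a) - cnj u * cnj u * (b * c))"
    by (simp add: K_def d algebra_simps)
  have "u - cnj u = 2 * \<i> * Im u" by (simp add: complex_eq_iff)
  then have "(u - cnj u) * (u - cnj u) = - 4 * (of_real (Im u))\<^sup>2" by (simp add: power2_eq_square)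
  then have uu: "u * u + cnj u * cnj u = 2 - 4 * (of_real (Im u))\<^sup>2"
    using u(1) by (simp add: algebra_simps)
  have "trace K = 2 * (u * cnj u * (a * cnj a)) - (b * c) * (u * u + cnj u * cnj u)"
    by (simp add: K_eq algebra_simps)
  also have "\<dots> = complex_of_real (2 + 4 * m * (Im u)\<^sup>2)"
    unfolding uu u(1) bc det by (simp add: algebra_simps)
  finally have tr: "Re (trace K) = 2 + 4 * m * (Im u)\<^sup>2" by simp
  then have "m * (Im u)\<^sup>2 \<le> 0" using elliptic_subgroup_trace(2)[OF G K] by simp
  then have "m \<le> 0" using u(2) by (simp add: mult_le_0_iff)
  moreover have "b = 0 \<and> c = 0" if "m = 0"
  proof -
    have "K = mat 1" using elliptic_subgroup_trace(3)[OF G K] tr that by simp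
    then have *: "a * b * (u * u - u * cnj u) = 0" "c * cnj a * (cnj u * cnj u - u * cnj u) = 0"
      unfolding K_eq one_mat2 mat2_eq_iff by blast+
    have "a \<noteq> 0" using det that by auto
    moreover have "u \<noteq> 0" using u(2) by auto
    moreover have "u \<noteq> cnj u" using u(2) by (metis complex_cnj_cancel_iff complex_cnj_cnj Im_complex_of_real Reals_cnj_iff complex_is_Real_iff)
    ultimately show ?thesis using * by (auto simp flip: left_diff_distrib right_diff_distrib)
  qed
  ultimately show "b \<noteq> 0 \<or> c \<noteq> 0 \<Longrightarrow> Im (b * c) = 0 \<and> Re (b * c) < 0"
    using bc by fastforce
qed

text \<open>
  The first part of the preceding lemma, applied to the product of \<open>h0\<close> and \<open>h\<close>, says
  \<open>c0 b = cnj (b0 c)\<close>. So the factor \<open>k\<close> in \<open>c = - k cnj b\<close> is the same for all elements.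
  Conjugation by a real diagonal matrix would turn \<open>k\<close> into 1 and the group into a subgroup of
  \<open>SU(2)\<close>; the fixed matrix below is the identity transported back.
\<close>

lemma diagonal_elliptic_subgroup_fixed_point:
  assumes G: "elliptic_subgroup G" and g: "mat2 u 0 0 (cnj u) \<in> G"
    and u: "u * cnj u = 1" "Im u \<noteq> 0"
  shows "\<exists>X\<in>hyperboloid. \<forall>A\<in>G. act A X = X"
proof -
  note diag = elliptic_subgroup_with_diagonal[OF G g u]
  have "\<exists>k::real. 0 < k \<and> (\<forall>a b c d. mat2 a b c d \<in> G \<longrightarrow> c = - of_real k * cnj b)"
  proof (cases "\<forall>a b c d. mat2 a b c d \<in> G \<longrightarrow> b = 0 \<and> c = 0")
    case True
    then have "\<forall>a b c d. mat2 a b c d \<in> G \<longrightarrow> c = - of_real 1 * cnj b"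
      by (metis complex_cnj_zero mult_zero_right)
    then show ?thesis using zero_less_one by blast
  next
    case False
    then obtain a0 b0 c0 d0 where h0: "mat2 a0 b0 c0 d0 \<in> G" and "b0 \<noteq> 0 \<or> c0 \<noteq> 0" by blast
    then have m: "Im (b0 * c0) = 0" "Re (b0 * c0) < 0" using diag(2) by blast+
    then have b0: "b0 \<noteq> 0" by auto
    define k where "k = - Re (b0 * c0) / (norm b0)\<^sup>2"
    have k: "0 < k" using m(2) b0 unfolding k_def by (intro divide_pos_pos) simp_all
    have "b0 * c0 = of_real (- k * (norm b0)\<^sup>2)"
      using m(1) b0 by (simp add: k_def complex_eq_iff)
    also have "\<dots> = b0 * (- of_real k * cnj b0)"
      unfolding of_real_mult complex_norm_square by simp
    finally have c0: "c0 = - of_real k * cnj b0" using b0 unfolding mult_cancel_left by simp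
    have "c = - of_real k * cnj b" if h: "mat2 a b c d \<in> G" for a b c d
    proof -
      have "mat2 a0 b0 c0 d0 ** mat2 a b c d \<in> G" using G h h0 unfolding elliptic_subgroup_def by blast
      then have "c0 * b + d0 * d = cnj (a0 * a + b0 * c)" unfolding mat2_mult by (rule diag(1))
      then have "cnj b0 * (- of_real k * b) = cnj b0 * cnj c"
        using diag(1)[OF h] diag(1)[OF h0] by (simp add: c0 mult_ac)
      then have "- of_real k * b = cnj c" using b0 unfolding mult_cancel_left by simp
      from arg_cong[OF this, of cnj] show ?thesis by simp
    qed
    then show ?thesis using k by blast
  qed
  then obtain k :: real where k: "0 < k" and c: "\<And>a b c d. mat2 a b c d \<in> G \<Longrightarrow> c = - of_real k * cnj b"
    by blast
  define s where "s = sqrt k"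
  have s: "0 < s" "k = s * s" using k by (simp_all add: s_def)
  have "act A (herm (1 / s) 0 s) = herm (1 / s) 0 s" if A: "A \<in> G" for A
  proof -
    obtain a b c d where Aeq: "A = mat2 a b c d" by (rule mat2_cases)
    have cd: "c = - of_real (s * s) * cnj b" "d = cnj a"
      using A c diag(1) by (auto simp: Aeq s(2))
    have "det A = 1" using A G by (auto simp: elliptic_subgroup_def)
    then have "a * cnj a = 1 - of_real s * of_real s * (b * cnj b)" by (simp add: Aeq cd algebra_simps)
    then have N: "a * cnj a + of_real s * of_real s * (b * cnj b) = 1" by simp
    have "act A (herm (1 / s) 0 s) = mat2 ((a * cnj a + of_real s * of_real s * (b * cnj b)) / of_real s) 0 0
        (of_real s * (a * cnj a + of_real s * of_real s * (b * cnj b)))"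
      using s(1) by (simp add: act_def Aeq cd herm_def field_simps)
    then show ?thesis unfolding N by (simp add: herm_def)
  qed
  moreover have "herm (1 / s) 0 s \<in> hyperboloid" using s by (simp add: hyperboloid_iff)
  ultimately show ?thesis by blast
qed

text \<open>
  Unless all elements are scalar, some element can be diagonalized by a unitary matrix after its fixed
  point has been moved to the identity matrix. Its diagonal entries are not real,
  since otherwise it would be a scalar.
\<close>

theorem elliptic_subgroup_fixed_point:
  assumes G: "elliptic_subgroup G"
  shows "\<exists>X\<in>hyperboloid. \<forall>A\<in>G. act A X = X"
proof (cases "\<forall>A\<in>G. \<exists>x::real. A = mat2 x 0 0 x")
  case True
  show ?thesis
  proof (intro bexI ballI)
    show "herm 1 0 1 \<in> hyperboloid" by (simp add: hyperboloid_iff)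
    fix A assume A: "A \<in> G"
    then obtain x :: real where x: "A = mat2 x 0 0 x" using True by blast
    have "det A = 1" using G A unfolding elliptic_subgroup_def by blast
    then have "complex_of_real x * of_real x = 1" unfolding x by simp
    then show "act A (herm 1 0 1) = herm 1 0 1" unfolding x act_def herm_def by simp
  qed
next
  case False
  then obtain g where g: "g \<in> G" and ns: "\<And>x::real. g \<noteq> mat2 x 0 0 x" by blast
  have detg: "det g = 1" using G g by (auto simp: elliptic_subgroup_def)
  obtain X where X: "X \<in> hyperboloid" "act g X = X" using G g by (auto simp: elliptic_subgroup_def)
  obtain C where C: "det C = 1" "dagger (C ** g ** adj2 C) = adj2 (C ** g ** adj2 C)"
    using elliptic_conj_SU2[OF detg X] by blast
  have "det (C ** g ** adj2 C) = 1" by (simp add: det_mul det_adj2 C detg)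
  then obtain a b where U: "C ** g ** adj2 C = mat2 a b (- cnj b) (cnj a)"
     and ab: "(norm a)\<^sup>2 + (norm b)\<^sup>2 = 1"
    using C(2) by (rule SU2_form)
  \<comment> \<open>The element of SU(2) is Re a plus \<i> times the traceless Hermitian matrix given by Im a and - \<i> * b.\<close>
  define r where "r = sqrt ((Im a)\<^sup>2 + (norm (- \<i> * b))\<^sup>2)"
  obtain B where B: "det B = 1"
    "\<And>(c::complex) (k::complex). B ** mat2 (c + k * Im a) (k * (- \<i> * b)) (k * cnj (- \<i> * b)) (c - k * Im a) ** adj2 B
       = mat2 (c + k * r) 0 0 (c - k * r)"
    using unitary_diagonalization[of "Im a" "- \<i> * b"] unfolding r_def by blast
  have mat: "mat2 a b (- cnj b) (cnj a) =
      mat2 (of_real (Re a) + \<i> * Im a) (\<i> * (- \<i> * b)) (\<i> * cnj (- \<i> * b)) (of_real (Re a) - \<i> * Im a)"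
    by (simp add: complex_eq_iff)
  have diag: "B ** (C ** g ** adj2 C) ** adj2 B = mat2 (of_real (Re a) + \<i> * r) 0 0 (of_real (Re a) - \<i> * r)"
    unfolding U mat by (rule B(2))
  define u where "u = of_real (Re a) + \<i> * r"
  define M where "M = B ** C"
  have M: "det M = 1" by (simp add: M_def det_mul B C)
  have "adj2 M = adj2 C ** adj2 B"
    by (rule mat2_cases[of B], rule mat2_cases[of C]) (simp add: M_def algebra_simps)
  then have "M ** g ** adj2 M = B ** (C ** g ** adj2 C) ** adj2 B" by (simp add: M_def matrix_mul_assoc)
  also have "\<dots> = mat2 u 0 0 (cnj u)" unfolding diag by (simp add: u_def)
  finally have gu: "mat2 u 0 0 (cnj u) \<in> (\<lambda>A. M ** A ** adj2 M) ` G" using g by (rule_tac image_eqI[of _ _ g]) simp_all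
  have "(norm u)\<^sup>2 = 1" using ab by (simp add: cmod_power2 u_def r_def norm_mult)
  then have u1: "u * cnj u = 1" using complex_norm_square[of u] by simp
  have "r \<noteq> 0"
  proof
    assume "r = 0"
    then have "Im a = 0" "b = 0" by (simp_all add: r_def norm_mult sum_power2_eq_zero_iff)
    then have "C ** g ** adj2 C = mat2 (Re a) 0 0 (Re a)" by (simp add: U complex_eq_iff)
    then have "g = adj2 C ** mat2 (Re a) 0 0 (Re a) ** C" using conjugate_cancel[OF C(1), of g] by simp
    also have "\<dots> = adj2 C ** C ** mat2 (Re a) 0 0 (Re a)"
    proof -
      have "mat2 (Re a) 0 0 (Re a) ** C = C ** mat2 (Re a) 0 0 (Re a)"
        by (rule mat2_cases[of C]) (simp add: mult.commute)
      then show ?thesis by (simp flip: matrix_mul_assoc)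
    qed
    also have "\<dots> = mat2 (Re a) 0 0 (Re a)" by (simp add: adj2_inverse[OF C(1)])
    finally show False using ns by blast
  qed
  then have u2: "Im u \<noteq> 0" by (simp add: u_def)
  obtain X where X: "X \<in> hyperboloid" "\<And>A. A \<in> G \<Longrightarrow> act (M ** A ** adj2 M) X = X"
    using diagonal_elliptic_subgroup_fixed_point[OF elliptic_subgroup_conjugate[OF G M] gu u1 u2] by blast
  have "act A (act (adj2 M) X) = act (adj2 M) X" if "A \<in> G" for A
  proof -
    have "act (adj2 M) (act (M ** A ** adj2 M) X) = act A (act (adj2 M) X)"
      by (simp add: act_mult M)
    then show ?thesis using X(2)[OF that] by simp
  qed
  moreover have "act (adj2 M) X \<in> hyperboloid" using X(1) M by (simp add: act_hyperboloid_iff det_adj2)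
  ultimately show ?thesis by (intro bexI[of _ "act (adj2 M) X"] ballI)
qed

section \<open>Nearest points and midpoints\<close>

text \<open>
  A positive definite matrix has a positive multiple on the hyperboloid. Hence the polar form with it
  is, up to a factor, the polar form with a point of the hyperboloid.
\<close>

lemma hyperboloid_normalize:
  assumes q: "0 < q" and d: "(norm w)\<^sup>2 < p * q"
  shows "\<exists>s>0. herm (p / s) (w /\<^sub>R s) (q / s) \<in> hyperboloid \<and>
    (\<forall>Y\<in>hyperboloid. polar (herm p w q) Y = s * polar (herm (p / s) (w /\<^sub>R s) (q / s)) Y)"
proof -
  define s where "s = sqrt (p * q - (norm w)\<^sup>2)"
  have s: "0 < s" "s * s = p * q - (norm w)\<^sup>2" using d by (simp_all add: s_def)
  have "p / s * (q / s) = p * q / (s * s)" by simp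
  also have "\<dots> = 1 + (norm w)\<^sup>2 / (s * s)" using s by (simp add: field_simps)
  also have "(norm w)\<^sup>2 / (s * s) = (norm (w /\<^sub>R s))\<^sup>2"
    using s(1) by (simp add: power2_eq_square divide_simps)
  finally have "herm (p / s) (w /\<^sub>R s) (q / s) \<in> hyperboloid"
    using q s(1) by (simp add: hyperboloid_iff)
  moreover have "polar (herm p w q) Y = s * polar (herm (p / s) (w /\<^sub>R s) (q / s)) Y"
    if "Y \<in> hyperboloid" for Y
    using that s(1) by (auto elim!: hyperboloid_cases simp: polar_herm field_simps)
  ultimately show ?thesis using s(1) by (intro exI[of _ s] conjI ballI)
qed

text \<open>
  The polar form is at least 2, with equality only on the diagonal; this is positivity of the
  distance. The identity behind it is
  \<open>q q' (polar X Y - 2) = (q - q')\<^sup>2 + |q' w - q w'|\<^sup>2\<close>.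
\<close>

lemma polar_le_2_imp_eq:
  assumes X: "X \<in> hyperboloid" and Y: "Y \<in> hyperboloid" and le: "polar X Y \<le> 2"
  shows "X = Y"
proof -
  obtain p w q where Xeq: "X = herm p w q" "0 < q" "p * q = 1 + (norm w)\<^sup>2"
    using X by (rule hyperboloid_cases)
  obtain p' w' q' where Yeq: "Y = herm p' w' q'" "0 < q'" "p' * q' = 1 + (norm w')\<^sup>2"
    using Y by (rule hyperboloid_cases)
  have "q * q' * polar X Y = q'\<^sup>2 * (p * q) + q\<^sup>2 * (p' * q') - 2 * q * q' * (w \<bullet> w')"
    by (simp add: Xeq(1) Yeq(1) polar_herm power2_eq_square algebra_simps)
  also have "\<dots> = (q - q')\<^sup>2 + 2 * q * q' + (norm (q' *\<^sub>R w - q *\<^sub>R w'))\<^sup>2"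
  proof -
    have "(norm (q' *\<^sub>R w - q *\<^sub>R w'))\<^sup>2 = q'\<^sup>2 * (norm w)\<^sup>2 + q\<^sup>2 * (norm w')\<^sup>2 - 2 * q * q' * (w \<bullet> w')"
      unfolding power2_norm_eq_inner
      by (simp add: inner_diff inner_commute power2_eq_square algebra_simps)
    then show ?thesis by (simp add: Xeq(3) Yeq(3) power2_diff algebra_simps)
  qed
  finally have "(q - q')\<^sup>2 + (norm (q' *\<^sub>R w - q *\<^sub>R w'))\<^sup>2 = q * q' * (polar X Y - 2)"
    by (simp add: algebra_simps)
  also have "\<dots> \<le> 0" using le Xeq(2) Yeq(2) by (intro mult_nonneg_nonpos) auto
  finally have "(q - q')\<^sup>2 + (norm (q' *\<^sub>R w - q *\<^sub>R w'))\<^sup>2 = 0"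
    by (smt (verit) zero_le_power2)
  then have "q - q' = 0" "q' *\<^sub>R w - q *\<^sub>R w' = 0"
    unfolding sum_power2_eq_zero_iff by auto
  then have "q = q'" "w = w'" using Xeq(2) by auto
  moreover from this have "p * q = p' * q" using Xeq(3) Yeq(3) by simp
  then have "p = p'" using Xeq(2) by simp
  ultimately show ?thesis using Xeq(1) Yeq(1) by simp
qed

lemma polar_self: "X \<in> hyperboloid \<Longrightarrow> polar X X = 2"
  by (auto elim!: hyperboloid_cases simp: polar_herm power2_norm_eq_inner)

lemma polar_ge_2:
  assumes "X \<in> hyperboloid" "Y \<in> hyperboloid" shows "2 \<le> polar X Y"
  using polar_le_2_imp_eq[OF assms] polar_self[OF assms(1)] by force

text \<open>
  The totally geodesic subspaces of dimension 1, 2 and 3 arise for the subspaces \<open>{0}\<close>, \<open>\<real>\<close> and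
  \<open>UNIV\<close> of the complex plane.
\<close>

definition slice :: "complex set \<Rightarrow> (complex^2^2) set" where
  "slice V = {X \<in> hyperboloid. X $ 1 $ 2 \<in> V}"

lemma slice_herm: "herm p w q \<in> slice V \<longleftrightarrow> herm p w q \<in> hyperboloid \<and> w \<in> V"
  by (simp add: slice_def herm_def)

text \<open>
  Projecting the off-diagonal entry orthogonally to \<open>V\<close> does not change the polar form with points
  of the slice. By \<open>polar_le_2_imp_eq\<close>, the point \<open>N\<close> is the only nearest point to \<open>X\<close>.
\<close>

lemma slice_nearest_point:
  assumes V: "subspace V" and X: "X \<in> hyperboloid"
  shows "\<exists>N\<in>slice V. \<exists>s>0. \<forall>Y\<in>slice V. polar X Y = s * polar N Y"
proof -
  obtain p w q where Xeq: "X = herm p w q" "0 < q" "p * q = 1 + (norm w)\<^sup>2"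
    using X by (rule hyperboloid_cases)
  obtain v z where v: "v \<in> span V" and z: "\<And>x. x \<in> span V \<Longrightarrow> orthogonal z x" and w: "w = v + z"
    using orthogonal_subspace_decomp_exists[of V w] by blast
  have span: "span V = V" using V by simp
  have vV: "v \<in> V" using v unfolding span .
  have "v \<bullet> z = 0" using z v by (simp add: orthogonal_def inner_commute)
  then have "(norm v)\<^sup>2 \<le> (norm w)\<^sup>2"
    by (simp add: w power2_norm_eq_inner inner_add inner_commute)
  then have "(norm v)\<^sup>2 < p * q" using Xeq(3) by linarith
  then obtain s where s: "0 < s" "herm (p / s) (v /\<^sub>R s) (q / s) \<in> hyperboloid"
    "\<forall>Y\<in>hyperboloid. polar (herm p v q) Y = s * polar (herm (p / s) (v /\<^sub>R s) (q / s)) Y"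
    using hyperboloid_normalize[OF Xeq(2)] by blast
  show ?thesis
  proof (intro bexI exI conjI ballI)
    show "herm (p / s) (v /\<^sub>R s) (q / s) \<in> slice V"
      using s(2) subspace_scale[OF V vV] by (simp add: slice_herm)
    show "0 < s" by fact
    fix Y assume Y: "Y \<in> slice V"
    then have Yh: "Y \<in> hyperboloid" by (simp add: slice_def)
    then obtain p' w' q' where Yeq: "Y = herm p' w' q'" by (rule hyperboloid_cases)
    have "w' \<in> span V" using Y unfolding span Yeq slice_herm by blast
    then have "z \<bullet> w' = 0" using z unfolding orthogonal_def by blast
    then have "polar X Y = polar (herm p v q) Y"
      by (simp add: Xeq(1) Yeq polar_herm w inner_add_left)
    then show "polar X Y = s * polar (herm (p / s) (v /\<^sub>R s) (q / s)) Y" using bspec[OF s(3) Yh] by simp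
  qed
qed

text \<open>
  The sum of the two matrices, normalized, is the midpoint: the only point at which the sum of the
  polar forms with \<open>N\<close> and \<open>N'\<close> is minimal.
\<close>

lemma slice_midpoint:
  assumes V: "subspace V" and N: "N \<in> slice V" "N' \<in> slice V"
  shows "\<exists>M\<in>slice V. \<exists>s>0. \<forall>Y\<in>slice V. polar N Y + polar N' Y = s * polar M Y"
proof -
  have H: "N \<in> hyperboloid" "N' \<in> hyperboloid" using N by (simp_all add: slice_def)
  obtain p w q where Neq: "N = herm p w q" "0 < q" "p * q = 1 + (norm w)\<^sup>2"
    using H(1) by (rule hyperboloid_cases)
  obtain p' w' q' where Neq': "N' = herm p' w' q'" "0 < q'" "p' * q' = 1 + (norm w')\<^sup>2"
    using H(2) by (rule hyperboloid_cases)
  have "2 \<le> p * q' + p' * q - 2 * (w \<bullet> w')"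
    using polar_ge_2[OF H] by (simp add: Neq(1) Neq'(1) polar_herm)
  then have "(norm (w + w'))\<^sup>2 < (p + p') * (q + q')"
    using Neq(3) Neq'(3) by (simp add: power2_norm_eq_inner inner_add inner_commute algebra_simps)
  then obtain s where s: "0 < s" "herm ((p + p') / s) ((w + w') /\<^sub>R s) ((q + q') / s) \<in> hyperboloid"
    "\<forall>Y\<in>hyperboloid.
      polar (herm (p + p') (w + w') (q + q')) Y = s * polar (herm ((p + p') / s) ((w + w') /\<^sub>R s) ((q + q') / s)) Y"
    using hyperboloid_normalize[OF add_pos_pos[OF Neq(2) Neq'(2)]] by blast
  show ?thesis
  proof (intro bexI exI conjI ballI)
    show "herm ((p + p') / s) ((w + w') /\<^sub>R s) ((q + q') / s) \<in> slice V"
      using s(2) N V by (simp add: Neq(1) Neq'(1) slice_herm subspace_scale subspace_add)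
    show "0 < s" by fact
    fix Y assume "Y \<in> slice V"
    then have Y: "Y \<in> hyperboloid" by (simp add: slice_def)
    then obtain a v b where Yeq: "Y = herm a v b" by (rule hyperboloid_cases)
    have "polar N Y + polar N' Y = polar (herm (p + p') (w + w') (q + q')) Y"
      by (simp add: Neq(1) Neq'(1) Yeq polar_herm inner_add algebra_simps)
    then show "polar N Y + polar N' Y = s * polar (herm ((p + p') / s) ((w + w') /\<^sub>R s) ((q + q') / s)) Y"
      using bspec[OF s(3) Y] by simp
  qed
qed

text \<open>
  The values off the slice carry no meaning, so composition and inversion are required only up to
  equality on the slice.

  Let \<open>plus\<close> be the property of being induced by a matrix without conjugation. The matrices so
  obtained have a common fixed point, and its nearest point \<open>N\<close> in the slice is
  fixed by all \<open>plus\<close> maps. A product of two maps that are not \<open>plus\<close> is \<open>plus\<close>; therefore the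
  other maps all interchange \<open>N\<close> with one further point, and the midpoint of the two is fixed
  by all of \<open>\<Gamma>\<close>.
\<close>

theorem slice_group_fixed_point:
  assumes V: "subspace V" and flag: "V = {0} \<or> 1 \<in> V \<and> (V \<subseteq> \<real> \<or> \<i> \<in> V)"
    and maps: "\<And>f X. f \<in> \<Gamma> \<Longrightarrow> X \<in> slice V \<Longrightarrow> f X \<in> slice V"
    and iso: "\<And>f X Y. f \<in> \<Gamma> \<Longrightarrow> X \<in> slice V \<Longrightarrow> Y \<in> slice V \<Longrightarrow> polar (f X) (f Y) = polar X Y"
    and comp: "\<And>f g. f \<in> \<Gamma> \<Longrightarrow> g \<in> \<Gamma> \<Longrightarrow> \<exists>h\<in>\<Gamma>. \<forall>X\<in>slice V. h X = f (g X)"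
    and inv: "\<And>f. f \<in> \<Gamma> \<Longrightarrow> \<exists>g\<in>\<Gamma>. \<forall>X\<in>slice V. g (f X) = X \<and> f (g X) = X"
    and fixed: "\<And>f. f \<in> \<Gamma> \<Longrightarrow> \<exists>X\<in>slice V. f X = X"
  shows "\<exists>X\<in>slice V. \<forall>f\<in>\<Gamma>. f X = X"
proof -
  let ?D = "slice V"
  have D: "?D \<subseteq> hyperboloid" by (auto simp: slice_def)
  have hyp: "X \<in> hyperboloid" if "X \<in> ?D" for X using that by (simp add: slice_def)
  define plus where "plus f \<longleftrightarrow> (\<exists>A. det A = 1 \<and> (\<forall>X\<in>?D. f X = act A X))" for f
  have nonplus: "\<exists>A. det A = 1 \<and> (\<forall>X\<in>?D. f X = act A (conj_mat X))" if f: "f \<in> \<Gamma>" "\<not> plus f" for f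
  proof -
    have "polar_preserving ?D f"
      using maps[OF f(1)] iso[OF f(1)] D unfolding polar_preserving_def by blast
    moreover have "herm 1 0 1 \<in> ?D" "herm 2 0 (1/2) \<in> ?D"
      using subspace_0[OF V] by (simp_all add: slice_herm hyperboloid_iff)
    moreover have "?D \<subseteq> {X. X $ 1 $ 2 = 0} \<or> herm 2 1 1 \<in> ?D \<and> (?D \<subseteq> {X. X $ 1 $ 2 \<in> \<real>} \<or> herm 2 \<i> 1 \<in> ?D)"
    proof -
      have "?D \<subseteq> {X. X $ 1 $ 2 \<in> V}" by (auto simp: slice_def)
      moreover have "1 \<in> V \<Longrightarrow> herm 2 1 1 \<in> ?D" "\<i> \<in> V \<Longrightarrow> herm 2 \<i> 1 \<in> ?D"
        by (simp_all add: slice_herm hyperboloid_iff)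
      ultimately show ?thesis using flag by blast
    qed
    ultimately show ?thesis using polar_preserving_extends[OF _ D] f(2) unfolding plus_def by blast
  qed
  define G where "G = {A. det A = 1 \<and> (\<exists>f\<in>\<Gamma>. \<forall>X\<in>?D. f X = act A X)}"
  have "elliptic_subgroup G"
    unfolding elliptic_subgroup_def
  proof (intro conjI ballI)
    fix A assume "A \<in> G"
    then obtain f where A: "det A = 1" and f: "f \<in> \<Gamma>" "\<And>X. X \<in> ?D \<Longrightarrow> f X = act A X"
      unfolding G_def by blast
    show "det A = 1" by fact
    obtain g where g: "g \<in> \<Gamma>" "\<And>X. X \<in> ?D \<Longrightarrow> f (g X) = X" using inv f by blast
    have "g X = act (adj2 A) X" if "X \<in> ?D" for X
      using act_adj2(1)[OF A, of "g X"] f(2)[of "g X"] g maps that by simp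
    then show "adj2 A \<in> G" unfolding G_def using g(1) A by (auto simp: det_adj2)
    obtain X where "X \<in> ?D" "f X = X" using fixed[OF f(1)] by blast
    then show "\<exists>X\<in>hyperboloid. act A X = X" using f(2) D by (intro bexI[of _ X]) auto
  next
    fix A B assume "A \<in> G" "B \<in> G"
    then obtain f g where AB: "det A = 1" "det B = 1"
      and f: "f \<in> \<Gamma>" "\<And>X. X \<in> ?D \<Longrightarrow> f X = act A X"
      and g: "g \<in> \<Gamma>" "\<And>X. X \<in> ?D \<Longrightarrow> g X = act B X"
      unfolding G_def by blast
    obtain h where h: "h \<in> \<Gamma>" "\<And>X. X \<in> ?D \<Longrightarrow> h X = f (g X)" using comp f(1) g(1) by blast
    have "h X = act (A ** B) X" if "X \<in> ?D" for X
      using h(2)[OF that] f(2)[OF maps[OF g(1) that]] g(2)[OF that] by (simp add: act_mult)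
    then show "A ** B \<in> G" unfolding G_def using h(1) AB by (auto simp: det_mul)
  qed
  then obtain X0 where X0: "X0 \<in> hyperboloid" "\<And>A. A \<in> G \<Longrightarrow> act A X0 = X0"
    using elliptic_subgroup_fixed_point by blast
  obtain N s where N: "N \<in> ?D" and s: "0 < s" "\<forall>Y\<in>?D. polar X0 Y = s * polar N Y"
    using slice_nearest_point[OF V X0(1)] by blast
  have fixN: "f N = N" if f: "f \<in> \<Gamma>" "plus f" for f
  proof -
    obtain A where A: "det A = 1" "\<And>X. X \<in> ?D \<Longrightarrow> f X = act A X" using f(2) unfolding plus_def by blast
    then have "A \<in> G" unfolding G_def using f(1) by blast
    have "s * polar N (f N) = polar X0 (f N)" using bspec[OF s(2) maps[OF f(1) N]] by simp
    also have "\<dots> = polar (act A X0) (act A N)" using X0(2)[OF \<open>A \<in> G\<close>] A(2)[OF N] by simp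
    also have "\<dots> = s * 2" by (simp add: polar_act[OF A(1)] bspec[OF s(2) N] polar_self[OF hyp[OF N]])
    finally have "polar N (f N) = 2" using s(1) by simp
    then show ?thesis using polar_le_2_imp_eq[OF hyp[OF N] hyp[OF maps[OF f(1) N]]] by simp
  qed
  have plus_comp: "plus h" if "f \<in> \<Gamma>" "g \<in> \<Gamma>" "\<not> plus f" "\<not> plus g"
      and h: "\<And>X. X \<in> ?D \<Longrightarrow> h X = f (g X)" for f g h
  proof -
    obtain A where A: "det A = 1" "\<And>X. X \<in> ?D \<Longrightarrow> f X = act A (conj_mat X)"
      using nonplus[OF \<open>f \<in> \<Gamma>\<close> \<open>\<not> plus f\<close>] by blast
    obtain B where B: "det B = 1" "\<And>X. X \<in> ?D \<Longrightarrow> g X = act B (conj_mat X)"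
      using nonplus[OF \<open>g \<in> \<Gamma>\<close> \<open>\<not> plus g\<close>] by blast
    have "h X = act (A ** conj_mat B) X" if "X \<in> ?D" for X
    proof -
      have "h X = act A (conj_mat (g X))" using h[OF that] A(2)[OF maps[OF \<open>g \<in> \<Gamma>\<close> that]] by simp
      then show ?thesis by (simp add: B(2)[OF that] conj_mat_act act_mult)
    qed
    moreover have "det (A ** conj_mat B) = 1" by (simp add: det_mul det_conj_mat A B)
    ultimately show ?thesis unfolding plus_def by blast
  qed
  have plus_cancel: "plus g" if "f \<in> \<Gamma>" "g \<in> \<Gamma>" "plus f" "plus h"
      and h: "\<And>X. X \<in> ?D \<Longrightarrow> h X = f (g X)" for f g h
  proof -
    obtain A where A: "det A = 1" "\<And>X. X \<in> ?D \<Longrightarrow> f X = act A X"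
      using \<open>plus f\<close> unfolding plus_def by blast
    obtain B where B: "det B = 1" "\<And>X. X \<in> ?D \<Longrightarrow> h X = act B X"
      using \<open>plus h\<close> unfolding plus_def by blast
    have "g X = act (adj2 A ** B) X" if X: "X \<in> ?D" for X
    proof -
      have "act A (g X) = act B X" using A(2)[OF maps[OF \<open>g \<in> \<Gamma>\<close> X]] h[OF X] B(2)[OF X] by simp
      then show ?thesis using act_adj2(1)[OF A(1), of "g X"] by (simp add: act_mult)
    qed
    moreover have "det (adj2 A ** B) = 1" by (simp add: det_mul det_adj2 A B)
    ultimately show ?thesis unfolding plus_def by blast
  qed
  show ?thesis
  proof (cases "\<forall>f\<in>\<Gamma>. plus f")
    case True
    then show ?thesis using N fixN by (intro bexI[of _ N] ballI) simp_all
  next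
    case False
    then obtain g where g: "g \<in> \<Gamma>" "\<not> plus g" by blast
    have N': "g N \<in> ?D" using maps g(1) N by blast
    have swap: "f N = g N \<and> f (g N) = N" if f: "f \<in> \<Gamma>" "\<not> plus f" for f
    proof
      obtain h where h: "h \<in> \<Gamma>" "\<And>X. X \<in> ?D \<Longrightarrow> h X = f (g X)" using comp f(1) g(1) by blast
      have "plus h" using plus_comp[OF f(1) g(1) f(2) g(2)] h(2) by blast
      then show "f (g N) = N" using fixN[OF h(1)] h(2)[OF N] by simp
      obtain f' where f': "f' \<in> \<Gamma>" "\<And>X. X \<in> ?D \<Longrightarrow> f' (f X) = X" "\<And>X. X \<in> ?D \<Longrightarrow> f (f' X) = X"
        using inv[OF f(1)] by blast
      have "plus (\<lambda>X. X)" unfolding plus_def by (intro exI[of _ "mat 1"]) simp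
      then have "\<not> plus f'" using plus_cancel[of f' f "\<lambda>X. X"] f f' by auto
      obtain k where k: "k \<in> \<Gamma>" "\<And>X. X \<in> ?D \<Longrightarrow> k X = f' (g X)" using comp f'(1) g(1) by blast
      have "plus k" using plus_comp[OF f'(1) g(1) \<open>\<not> plus f'\<close> g(2)] k(2) by blast
      then have "f' (g N) = N" using fixN[OF k(1)] k(2)[OF N] by simp
      then show "f N = g N" using f'(3)[OF N'] by simp
    qed
    have perm: "f N = N \<and> f (g N) = g N \<or> f N = g N \<and> f (g N) = N" if f: "f \<in> \<Gamma>" for f
    proof (cases "plus f")
      case True
      obtain h where h: "h \<in> \<Gamma>" "\<And>X. X \<in> ?D \<Longrightarrow> h X = f (g X)" using comp f g(1) by blast
      have "\<not> plus h" using plus_cancel[OF f g(1) True] h(2) g(2) by blast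
      then have "f (g N) = g N" using swap[OF h(1)] h(2)[OF N] by simp
      then show ?thesis using fixN[OF f True] by simp
    qed (use swap f in blast)
    obtain M s where M: "M \<in> ?D" and s: "0 < s"
        "\<forall>Y\<in>?D. polar N Y + polar (g N) Y = s * polar M Y"
      using slice_midpoint[OF V N N'] by blast
    have "f M = M" if f: "f \<in> \<Gamma>" for f
    proof -
      have "s * polar M (f M) = polar N (f M) + polar (g N) (f M)" using bspec[OF s(2) maps[OF f M]] by simp
      also have "\<dots> = polar (f N) (f M) + polar (f (g N)) (f M)" using perm[OF f] by auto
      also have "\<dots> = s * polar M M" using iso[OF f] N N' M bspec[OF s(2) M] by simp
      finally have "polar M (f M) = 2" using s(1) polar_self[OF hyp[OF M]] by simp
      then show ?thesis using polar_le_2_imp_eq[OF hyp[OF M] hyp[OF maps[OF f M]]] by simp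
    qed
    then show ?thesis using M by (intro bexI[of _ M] ballI)
  qed
qed

section \<open>Dimension at most three\<close>

text \<open>
  The at most two coordinates besides the last one are identified isometrically with the points of
  \<open>{0}\<close>, \<open>\<real>\<close> or the complex plane.
\<close>

lemma planar_coordinates_exist:
  fixes J :: "'i set"
  assumes "finite J" "card J \<le> 2"
  shows "\<exists>(c :: 'i \<Rightarrow> complex) V. subspace V \<and> (V = {0} \<or> 1 \<in> V \<and> (V \<subseteq> \<real> \<or> \<i> \<in> V)) \<and>
     V = range (\<lambda>a. \<Sum>i\<in>J. a i *\<^sub>R c i) \<and> (\<forall>a. (norm (\<Sum>i\<in>J. a i *\<^sub>R c i))\<^sup>2 = (\<Sum>i\<in>J. (a i)\<^sup>2))"
proof -
  consider "J = {}" | i where "J = {i}" | i j where "J = {i, j}" "i \<noteq> j"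
  proof -
    have "card J = 0 \<or> card J = 1 \<or> card J = 2" using assms(2) by linarith
    then show thesis using that assms(1) by (auto simp: card_1_singleton_iff card_2_iff)
  qed
  then show ?thesis
  proof cases
    case 1
    then show ?thesis by (intro exI[of _ "\<lambda>_. 1"] exI[of _ "{0}"]) auto
  next
    case (2 i)
    have "\<real> = range (\<lambda>a. a i *\<^sub>R (1 :: complex))"
    proof
      show "\<real> \<subseteq> range (\<lambda>a. a i *\<^sub>R (1 :: complex))"
      proof
        fix x :: complex assume "x \<in> \<real>"
        then obtain r where "x = of_real r" by (auto elim: Reals_cases)
        then show "x \<in> range (\<lambda>a. a i *\<^sub>R (1 :: complex))"
          by (intro image_eqI[of _ _ "\<lambda>_. r"]) (simp_all add: scaleR_conv_of_real)
      qed
    qed (auto simp: scaleR_conv_of_real)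
    moreover have "subspace (\<real> :: complex set)"
      by (auto simp: subspace_def scaleR_conv_of_real)
    ultimately show ?thesis
      by (intro exI[of _ "\<lambda>_. 1"] exI[of _ "\<real>"]) (simp add: 2)
  next
    case (3 i j)
    define c :: "'i \<Rightarrow> complex" where "c = (\<lambda>k. if k = i then 1 else \<i>)"
    have sum: "(\<Sum>k\<in>J. a k *\<^sub>R c k) = Complex (a i) (a j)" for a
      using 3 by (simp add: c_def complex_eq_iff)
    have "UNIV = range (\<lambda>a. \<Sum>k\<in>J. a k *\<^sub>R c k)"
    proof -
      have "z \<in> range (\<lambda>a. \<Sum>k\<in>J. a k *\<^sub>R c k)" for z
        unfolding sum using 3(2)
        by (intro image_eqI[of _ _ "\<lambda>k. if k = i then Re z else Im z"]) (simp_all add: complex_eq_iff)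
      then show ?thesis by blast
    qed
    moreover have "(norm (\<Sum>k\<in>J. a k *\<^sub>R c k))\<^sup>2 = (\<Sum>k\<in>J. (a k)\<^sup>2)" for a
      unfolding sum using 3 by (simp add: cmod_power2)
    ultimately show ?thesis by (intro exI[of _ c] exI[of _ UNIV]) simp
  qed
qed

text \<open>
  The matrix that represents the point at height \<open>t\<close> over \<open>z\<close> in the upper half-space.
\<close>

definition hyp_point :: "complex \<Rightarrow> real \<Rightarrow> complex^2^2" where
  "hyp_point z t = herm (((norm z)\<^sup>2 + t\<^sup>2) / t) (z /\<^sub>R t) (1 / t)"

lemma hyp_point_hyperboloid:
  assumes "0 < t" shows "hyp_point z t \<in> hyperboloid"
proof -
  have "(norm (z /\<^sub>R t))\<^sup>2 = (norm z)\<^sup>2 / t\<^sup>2" using assms by (simp add: power_mult_distrib divide_simps)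
  then show ?thesis
    using assms by (simp add: hyp_point_def hyperboloid_iff) (simp add: field_simps power2_eq_square)
qed

lemma polar_hyp_point:
  assumes "0 < t" "0 < t'"
  shows "polar (hyp_point z t) (hyp_point z' t') = 2 * (1 + ((norm (z - z'))\<^sup>2 + (t - t')\<^sup>2) / (2 * t * t'))"
proof -
  have "(norm (z - z'))\<^sup>2 = (norm z)\<^sup>2 + (norm z')\<^sup>2 - 2 * (z \<bullet> z')"
    unfolding power2_norm_eq_inner by (simp add: inner_diff inner_commute)
  then show ?thesis
    using assms unfolding hyp_point_def polar_herm by (simp only:) (simp add: field_simps power2_eq_square)
qed

text \<open>
  The bijection \<open>\<phi>\<close> carries \<open>G\<close> to a group of isometries of the slice.
\<close>

theorem fixating_if_hyperboloid_slice:
  fixes \<phi> :: "'a \<Rightarrow> complex^2^2"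
  assumes V: "subspace V" "V = {0} \<or> 1 \<in> V \<and> (V \<subseteq> \<real> \<or> \<i> \<in> V)"
    and \<phi>: "bij_betw \<phi> X (slice V)"
    and G: "subgroup G (BijGroup X)"
    and iso: "\<And>g x y. g \<in> G \<Longrightarrow> x \<in> X \<Longrightarrow> y \<in> X \<Longrightarrow> polar (\<phi> (g x)) (\<phi> (g y)) = polar (\<phi> x) (\<phi> y)"
  shows "fixating X G"
  unfolding fixating_def
proof (intro allI impI)
  fix H assume H': "subgroup H ((BijGroup X)\<lparr>carrier := G\<rparr>)" and GAF: "GAF X H"
  have H: "subgroup H (BijGroup X)" by (rule group.incl_subgroup[OF group_BijGroup G H'])
  have HG: "H \<subseteq> G" using subgroup.subset[OF H'] by simp
  have Bij: "g \<in> Bij X" if "g \<in> H" for g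
    using subgroup.subset[OF H] that by (auto simp: BijGroup_def)
  have gX: "g x \<in> X" if "g \<in> H" "x \<in> X" for g x
    using Bij_imp_funcset[OF Bij[OF that(1)]] that(2) by blast
  define \<psi> where "\<psi> = inv_into X \<phi>"
  have \<phi>X: "\<phi> x \<in> slice V" if "x \<in> X" for x using \<phi> that by (auto simp: bij_betw_def)
  have \<psi>X: "\<psi> Y \<in> X" and \<phi>\<psi>: "\<phi> (\<psi> Y) = Y" if "Y \<in> slice V" for Y
    using \<phi> that by (auto simp: \<psi>_def bij_betw_def inv_into_into f_inv_into_f)
  have \<psi>\<phi>: "\<psi> (\<phi> x) = x" if "x \<in> X" for x
    using \<phi> that by (simp add: \<psi>_def bij_betw_def)
  define \<Gamma> where "\<Gamma> = (\<lambda>g Y. \<phi> (g (\<psi> Y))) ` H"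
  have "\<exists>Y\<in>slice V. \<forall>f\<in>\<Gamma>. f Y = Y"
  proof (rule slice_group_fixed_point[OF V])
    show "f Y \<in> slice V" if "f \<in> \<Gamma>" "Y \<in> slice V" for f Y
      using that by (auto simp: \<Gamma>_def \<phi>X gX \<psi>X)
    show "polar (f Y) (f Z) = polar Y Z" if "f \<in> \<Gamma>" and Y: "Y \<in> slice V" and Z: "Z \<in> slice V" for f Y Z
    proof -
      obtain g where g: "g \<in> H" "f = (\<lambda>Y. \<phi> (g (\<psi> Y)))" using \<open>f \<in> \<Gamma>\<close> by (auto simp: \<Gamma>_def)
      then have "g \<in> G" using HG by blast
      then show ?thesis using iso[of g "\<psi> Y" "\<psi> Z"] by (simp add: g(2) \<psi>X \<phi>\<psi> Y Z)
    qed
    show "\<exists>h\<in>\<Gamma>. \<forall>Y\<in>slice V. h Y = f (g Y)" if fg: "f \<in> \<Gamma>" "g \<in> \<Gamma>" for f g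
    proof -
      obtain f' g' where f': "f' \<in> H" "f = (\<lambda>Y. \<phi> (f' (\<psi> Y)))"
        and g': "g' \<in> H" "g = (\<lambda>Y. \<phi> (g' (\<psi> Y)))" using fg by (auto simp: \<Gamma>_def)
      have "f' \<otimes>\<^bsub>BijGroup X\<^esub> g' \<in> H" using subgroup.m_closed[OF H] f' g' by blast
      then have "compose X f' g' \<in> H" using Bij f' g' by (simp add: BijGroup_def)
      then show ?thesis
        unfolding \<Gamma>_def
        by (intro bexI[of _ "\<lambda>Y. \<phi> (compose X f' g' (\<psi> Y))"]) (auto simp: f' g' compose_eq \<psi>X \<psi>\<phi> gX)
    qed
    show "\<exists>g\<in>\<Gamma>. \<forall>Y\<in>slice V. g (f Y) = Y \<and> f (g Y) = Y" if f: "f \<in> \<Gamma>" for f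
    proof -
      obtain f' where f': "f' \<in> H" "f = (\<lambda>Y. \<phi> (f' (\<psi> Y)))" using f by (auto simp: \<Gamma>_def)
      define g' where "g' = restrict (inv_into X f') X"
      have "inv\<^bsub>BijGroup X\<^esub> f' \<in> H" using subgroup.m_inv_closed[OF H f'(1)] .
      then have g': "g' \<in> H" using inv_BijGroup[OF Bij[OF f'(1)]] by (simp add: g'_def)
      have "bij_betw f' X X" using Bij[OF f'(1)] by (simp add: Bij_def)
      then have "g' (f' x) = x" "f' (g' x) = x" if "x \<in> X" for x
        using that gX[OF f'(1)] by (auto simp: g'_def bij_betw_def f_inv_into_f)
      then show ?thesis
        unfolding \<Gamma>_def using g'
        by (intro bexI[of _ "\<lambda>Y. \<phi> (g' (\<psi> Y))"]) (auto simp: f' \<psi>X \<psi>\<phi> \<phi>\<psi> gX)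
    qed
    show "\<exists>Y\<in>slice V. f Y = Y" if f: "f \<in> \<Gamma>" for f
    proof -
      obtain f' where f': "f' \<in> H" "f = (\<lambda>Y. \<phi> (f' (\<psi> Y)))" using f by (auto simp: \<Gamma>_def)
      obtain x where "x \<in> X" "f' x = x" using GAF f'(1) by (auto simp: GAF_def Fix_def)
      then show ?thesis by (intro bexI[of _ "\<phi> x"]) (auto simp: f' \<psi>\<phi> \<phi>X)
    qed
  qed
  then obtain Y where Y: "Y \<in> slice V" "\<forall>f\<in>\<Gamma>. f Y = Y" by blast
  have "\<psi> Y \<in> Fix X g" if g: "g \<in> H" for g
  proof -
    have "(\<lambda>Y. \<phi> (g (\<psi> Y))) \<in> \<Gamma>" using g by (simp add: \<Gamma>_def)
    from bspec[OF Y(2) this] have "\<phi> (g (\<psi> Y)) = Y" .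
    then have "g (\<psi> Y) = \<psi> Y" using \<psi>\<phi>[OF gX[OF g \<psi>X[OF Y(1)]]] by simp
    then show ?thesis using \<psi>X[OF Y(1)] by (simp add: Fix_def)
  qed
  then show "GAG X H" by (auto simp: GAG_def)
qed

theorem fixating_hyp_isometries:
  assumes "CARD('n::{finite,linorder}) \<le> 3"
  shows "fixating (hyp_space :: (real ^ 'n::{finite,linorder}) set) hyp_isometries"
proof -
  let ?X = "hyp_space :: (real ^ 'n::{finite,linorder}) set"
  define k :: 'n where "k = Max UNIV"
  have "card (UNIV - {k}) \<le> 2" using assms by simp
  then obtain c :: "'n \<Rightarrow> complex" and V where V: "subspace V" "V = {0} \<or> 1 \<in> V \<and> (V \<subseteq> \<real> \<or> \<i> \<in> V)"
    and Vr: "V = range (\<lambda>a. \<Sum>i\<in>UNIV - {k}. a i *\<^sub>R c i)"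
    and norm_c: "\<And>a. (norm (\<Sum>i\<in>UNIV - {k}. a i *\<^sub>R c i))\<^sup>2 = (\<Sum>i\<in>UNIV - {k}. (a i)\<^sup>2)"
    using planar_coordinates_exist[of "UNIV - {k}"] by auto
  define z where "z x = (\<Sum>i\<in>UNIV - {k}. x $ i *\<^sub>R c i)" for x :: "real ^ 'n::{finite,linorder}"
  have zV: "z x \<in> V" for x unfolding Vr z_def by blast
  have norm_z: "(norm (x - y))\<^sup>2 = (norm (z x - z y))\<^sup>2 + (last_coord x - last_coord y)\<^sup>2" for x y
  proof -
    have "z x - z y = (\<Sum>i\<in>UNIV - {k}. (x $ i - y $ i) *\<^sub>R c i)"
      by (simp add: z_def sum_subtractf scaleR_diff_left)
    then have "(norm (z x - z y))\<^sup>2 = (\<Sum>i\<in>UNIV - {k}. (x $ i - y $ i)\<^sup>2)" using norm_c by simp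
    moreover have "(norm (x - y))\<^sup>2 = (\<Sum>i\<in>UNIV. (x $ i - y $ i)\<^sup>2)"
      unfolding power2_norm_eq_inner by (simp add: inner_vec_def power2_eq_square)
    ultimately show ?thesis
      by (simp add: sum.remove[of UNIV k] last_coord_def flip: k_def)
  qed
  define \<phi> where "\<phi> x = hyp_point (z x) (last_coord x)" for x
  have pos: "0 < last_coord x" if "x \<in> ?X" for x using that by (simp add: hyp_space_def)
  have polar: "polar (\<phi> x) (\<phi> y) = 2 * cosh (hyp_dist x y)" if "x \<in> ?X" "y \<in> ?X" for x y
  proof -
    have "0 < last_coord x" "0 < last_coord y" using pos that by blast+
    then have "cosh (hyp_dist x y) = 1 + (norm (x - y))\<^sup>2 / (2 * last_coord x * last_coord y)"
      unfolding hyp_dist_def by (intro cosh_arcosh_real) simp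
    then show ?thesis using pos that by (simp add: \<phi>_def polar_hyp_point norm_z)
  qed
  have "bij_betw \<phi> ?X (slice V)"
    unfolding bij_betw_def
  proof
    show "inj_on \<phi> ?X"
    proof (rule inj_onI)
      fix x y assume xy: "x \<in> ?X" "y \<in> ?X" "\<phi> x = \<phi> y"
      have "polar (\<phi> x) (\<phi> y) = 2"
        using xy(3) polar_self[of "\<phi> y"] pos[OF xy(2)] by (simp add: \<phi>_def hyp_point_hyperboloid)
      then have "(norm (x - y))\<^sup>2 = 0"
        using pos[OF xy(1)] pos[OF xy(2)] by (simp add: \<phi>_def polar_hyp_point flip: norm_z)
      then show "x = y" by simp
    qed
    show "\<phi> ` ?X = slice V"
    proof
      show "\<phi> ` ?X \<subseteq> slice V"
      proof
        fix Y assume "Y \<in> \<phi> ` ?X"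
        then obtain x where x: "x \<in> ?X" "Y = \<phi> x" by blast
        have "Y \<in> hyperboloid" using x pos by (simp add: \<phi>_def hyp_point_hyperboloid)
        moreover have "z x /\<^sub>R last_coord x \<in> V" by (rule subspace_scale[OF V(1) zV])
        ultimately show "Y \<in> slice V" by (simp add: x(2) \<phi>_def hyp_point_def slice_herm)
      qed
      show "slice V \<subseteq> \<phi> ` ?X"
      proof
        fix Y assume Y: "Y \<in> slice V"
        then have "Y \<in> hyperboloid" by (simp add: slice_def)
        then obtain p w q where Yeq: "Y = herm p w q" "0 < p" "0 < q" "p * q = 1 + (norm w)\<^sup>2"
          by (rule hyperboloid_cases)
        have p: "p = (1 + (norm w)\<^sup>2) / q" using Yeq(3,4) by (simp add: field_simps)
        have "w \<in> V" using Y by (simp add: Yeq(1) slice_herm)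
        then have "w /\<^sub>R q \<in> V" by (rule subspace_scale[OF V(1)])
        then obtain a where a: "(\<Sum>i\<in>UNIV - {k}. a i *\<^sub>R c i) = w /\<^sub>R q" unfolding Vr by auto
        define x where "x = (\<chi> i. if i = k then 1 / q else a i)"
        have lx: "last_coord x = 1 / q" by (simp add: x_def last_coord_def k_def)
        have "z x = (\<Sum>i\<in>UNIV - {k}. a i *\<^sub>R c i)" unfolding z_def x_def by (intro sum.cong) simp_all
        then have zx: "z x = w /\<^sub>R q" using a by simp
        have "(norm (w /\<^sub>R q))\<^sup>2 = (norm w)\<^sup>2 / q\<^sup>2" using Yeq(3) by (simp add: power_mult_distrib divide_simps)
        then have "((norm (w /\<^sub>R q))\<^sup>2 + (1 / q)\<^sup>2) / (1 / q) = p"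
          using Yeq(3) by (simp add: p field_simps power2_eq_square)
        then have "\<phi> x = Y" using Yeq(3) by (simp add: \<phi>_def lx zx hyp_point_def Yeq(1))
        moreover have "x \<in> ?X" using Yeq(3) by (simp add: hyp_space_def lx)
        ultimately show "Y \<in> \<phi> ` ?X" by blast
      qed
    qed
  qed
  then show ?thesis
  proof (rule fixating_if_hyperboloid_slice[OF V _ subgroup_hyp_isometries])
    fix g :: "real ^ 'n::{finite,linorder} \<Rightarrow> real ^ 'n::{finite,linorder}" and x y
    assume g: "g \<in> hyp_isometries" and xy: "x \<in> ?X" "y \<in> ?X"
    have "g \<in> Bij ?X" using g by (simp add: hyp_isometries_def BijGroup_def)
    then have "g x \<in> ?X" "g y \<in> ?X" using Bij_imp_funcset xy by blast+
    moreover have "hyp_dist (g x) (g y) = hyp_dist x y" using g xy by (simp add: hyp_isometries_def)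
    ultimately show "polar (\<phi> (g x)) (\<phi> (g y)) = polar (\<phi> x) (\<phi> y)" using polar xy by simp
  qed
qed

section \<open>A group of affine maps of the quaternions\<close>

text \<open>
  Quaternions \<open>a + b i + c j + d k\<close> are vectors of length 4, so that the Euclidean metric is at hand.
\<close>

definition quat :: "real \<Rightarrow> real \<Rightarrow> real \<Rightarrow> real \<Rightarrow> real^4" where
  "quat a b c d = vector [a, b, c, d]"

lemma quat_nth [simp]:
  "quat a b c d $ 1 = a" "quat a b c d $ 2 = b" "quat a b c d $ 3 = c" "quat a b c d $ 4 = d"
  by (simp_all add: quat_def vector_def)

lemma quat_eq_iff:
  fixes x y :: "real^4"
  shows "x = y \<longleftrightarrow> x $ 1 = y $ 1 \<and> x $ 2 = y $ 2 \<and> x $ 3 = y $ 3 \<and> x $ 4 = y $ 4"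
  by (simp add: vec_eq_iff forall_4)

lemma norm_quat: "(norm (x :: real^4))\<^sup>2 = (x $ 1)\<^sup>2 + (x $ 2)\<^sup>2 + (x $ 3)\<^sup>2 + (x $ 4)\<^sup>2"
  unfolding power2_norm_eq_inner by (simp add: inner_vec_def sum_4 power2_eq_square)

definition qmul :: "real^4 \<Rightarrow> real^4 \<Rightarrow> real^4" where
  "qmul p x = quat
     (p $ 1 * x $ 1 - p $ 2 * x $ 2 - p $ 3 * x $ 3 - p $ 4 * x $ 4)
     (p $ 1 * x $ 2 + p $ 2 * x $ 1 + p $ 3 * x $ 4 - p $ 4 * x $ 3)
     (p $ 1 * x $ 3 - p $ 2 * x $ 4 + p $ 3 * x $ 1 + p $ 4 * x $ 2)
     (p $ 1 * x $ 4 + p $ 2 * x $ 3 - p $ 3 * x $ 2 + p $ 4 * x $ 1)"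

definition qconj :: "real^4 \<Rightarrow> real^4" where
  "qconj p = quat (p $ 1) (- p $ 2) (- p $ 3) (- p $ 4)"

abbreviation qone :: "real^4" where "qone \<equiv> quat 1 0 0 0"

lemma qmul_one [simp]: "qmul qone x = x"
  by (simp add: qmul_def quat_eq_iff)

lemma qmul_assoc: "qmul (qmul p q) x = qmul p (qmul q x)"
  by (simp add: qmul_def quat_eq_iff algebra_simps)

lemma qmul_add: "qmul p (x + y) = qmul p x + qmul p y"
  by (simp add: qmul_def quat_eq_iff algebra_simps)

lemma qmul_diff: "qmul p (x - y) = qmul p x - qmul p y"
  by (simp add: qmul_def quat_eq_iff algebra_simps)

lemma qmul_scaleR: "qmul p (c *\<^sub>R x) = c *\<^sub>R qmul p x"
  by (simp add: qmul_def quat_eq_iff algebra_simps)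

lemma qmul_diff_left: "qmul (p - q) x = qmul p x - qmul q x"
  by (simp add: qmul_def quat_eq_iff algebra_simps)

lemma norm_qmul: "norm (qmul p x) = norm p * norm x"
proof -
  have "(norm (qmul p x))\<^sup>2 = (norm p * norm x)\<^sup>2"
    unfolding power_mult_distrib norm_quat
    by (simp add: qmul_def) algebra
  then show ?thesis by simp
qed

lemma qmul_qconj: "qmul p (qmul (qconj p) x) = (norm p)\<^sup>2 *\<^sub>R x"
  unfolding norm_quat
  by (simp add: qmul_def qconj_def quat_eq_iff power2_eq_square algebra_simps)

lemma qconj_qmul: "qmul (qconj p) (qmul p x) = (norm p)\<^sup>2 *\<^sub>R x"
  unfolding norm_quat
  by (simp add: qmul_def qconj_def quat_eq_iff power2_eq_square algebra_simps)

text \<open>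
  The equation is \<open>(1 - p) x = v\<close>, and \<open>1 - p\<close> is invertible with inverse
  \<open>qconj (1 - p) / |1 - p|\<^sup>2\<close>.
\<close>

lemma affine_qmul_fixed_point:
  assumes "p \<noteq> qone"
  shows "\<exists>x. qmul p x + v = x"
proof -
  define r where "r = qone - p"
  have r: "norm r \<noteq> 0" using assms by (simp add: r_def)
  define x where "x = qmul (qconj r) ((1 / (norm r)\<^sup>2) *\<^sub>R v)"
  have "qmul r x = v" using r by (simp add: x_def qmul_qconj)
  then have "x - qmul p x = v" by (simp add: r_def qmul_diff_left)
  then show ?thesis by (metis add.commute diff_add_cancel)
qed

lemma qmul_eq_self:
  assumes "qmul p x = x" "p \<noteq> qone" shows "x = 0"
proof -
  have "qmul (qone - p) x = 0" using assms by (simp add: qmul_diff_left)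
  then have "(norm (qone - p))\<^sup>2 *\<^sub>R x = qmul (qconj (qone - p)) 0" using qconj_qmul by metis
  also have "\<dots> = 0" by (simp add: qmul_def quat_eq_iff)
  finally show ?thesis using assms(2) by simp
qed

text \<open>
  A letter is a generator together with a sign: \<open>(Gen_i, True)\<close> stands for \<open>1 + 2 i\<close> and
  \<open>(Gen_i, False)\<close> for \<open>1 - 2 i\<close>, and likewise for \<open>j\<close>.
\<close>

datatype gen = Gen_i | Gen_j

definition inv_letter :: "gen \<times> bool \<Rightarrow> gen \<times> bool" where
  "inv_letter l = (fst l, \<not> snd l)"

fun reduced :: "(gen \<times> bool) list \<Rightarrow> bool" where
  "reduced (l # m # w) \<longleftrightarrow> m \<noteq> inv_letter l \<and> reduced (m # w)"
| "reduced w \<longleftrightarrow> True"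

lemma not_reducedE:
  assumes "\<not> reduced w"
  obtains u l v where "w = u @ l # inv_letter l # v"
proof -
  have "\<exists>u l v. w = u @ l # inv_letter l # v"
    using assms
  proof (induction w rule: reduced.induct)
    case (1 l m w)
    show ?case
    proof (cases "m = inv_letter l")
      case True
      then show ?thesis by (metis append_Nil)
    next
      case False
      then have "\<not> reduced (m # w)" using 1(2) by simp
      then show ?thesis using 1(1) False by (metis append_Cons)
    qed
  qed simp_all
  then show thesis using that by blast
qed

fun signed_two :: "bool \<Rightarrow> int" where "signed_two s = (if s then 2 else - 2)"

text \<open>
  Left multiplication of an integral quaternion by the integral quaternion that a letter stands for.
\<close>

fun int_mul :: "gen \<times> bool \<Rightarrow> int \<times> int \<times> int \<times> int \<Rightarrow> int \<times> int \<times> int \<times> int" where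
  "int_mul (Gen_i, s) (a, b, c, d) = (a - signed_two s * b, b + signed_two s * a, c - signed_two s * d, d + signed_two s * c)"
| "int_mul (Gen_j, s) (a, b, c, d) = (a - signed_two s * c, b + signed_two s * d, c + signed_two s * a, d - signed_two s * b)"

definition int_word :: "(gen \<times> bool) list \<Rightarrow> int \<times> int \<times> int \<times> int" where
  "int_word w = foldr int_mul w (1, 0, 0, 0)"

text \<open>
  Modulo 5 the quaternions form the algebra of two-by-two matrices over the field with 5 elements, in
  which each letter has rank 1. The right ideal that it generates is cut out by two
  linear congruences, and the four ideals of the letters belong to distinct lines, so they meet
  pairwise in 0 only (\<open>right_ideal_inter\<close>).
\<close>

fun right_ideal :: "gen \<times> bool \<Rightarrow> int \<times> int \<times> int \<times> int \<Rightarrow> bool" where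
  "right_ideal (Gen_i, s) (a, b, c, d) \<longleftrightarrow> 5 dvd b - signed_two s * a \<and> 5 dvd d - signed_two s * c"
| "right_ideal (Gen_j, s) (a, b, c, d) \<longleftrightarrow> 5 dvd c - signed_two s * a \<and> 5 dvd d + signed_two s * b"

fun dvd5 :: "int \<times> int \<times> int \<times> int \<Rightarrow> bool" where
  "dvd5 (a, b, c, d) \<longleftrightarrow> 5 dvd a \<and> 5 dvd b \<and> 5 dvd c \<and> 5 dvd d"

lemma right_ideal_int_mul: "right_ideal l (int_mul l x)"
proof (cases x)
  case (fields a b c d)
  obtain g s where l: "l = (g, s)" by (cases l)
  show ?thesis by (cases g; cases s; simp add: l fields; presburger)
qed

text \<open>
  The annihilator of a letter modulo 5 is the right ideal of the inverse letter.
\<close>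

lemma dvd5_int_mul:
  assumes "dvd5 (int_mul l x)" shows "right_ideal (inv_letter l) x"
proof (cases x)
  case (fields a b c d)
  obtain g s where l: "l = (g, s)" by (cases l)
  show ?thesis using assms
    by (cases g; cases s; simp add: l fields inv_letter_def; presburger)
qed

lemma right_ideal_inter:
  assumes "right_ideal l x" "right_ideal m x" "l \<noteq> m" shows "dvd5 x"
proof (cases x)
  case (fields a b c d)
  obtain g s where l: "l = (g, s)" by (cases l)
  obtain h t where m: "m = (h, t)" by (cases m)
  show ?thesis using assms
    by (cases g; cases s; cases h; cases t; simp add: l m fields; presburger)
qed

text \<open>
  If the word \<open>m # w\<close> is nonzero modulo 5 and lies in the ideal of \<open>m\<close>, then multiplication by \<open>l\<close>
  can only kill it if it lies in the ideal of the inverse of \<open>l\<close> too, which is excluded as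
  the word is reduced.
\<close>

lemma reduced_word_not_dvd5:
  assumes "reduced w" "w \<noteq> []"
  shows "right_ideal (hd w) (int_word w) \<and> \<not> dvd5 (int_word w)"
  using assms
proof (induction w rule: reduced.induct)
  case (1 l m w)
  then have IH: "right_ideal m (int_word (m # w))" "\<not> dvd5 (int_word (m # w))" and "m \<noteq> inv_letter l"
    by auto
  have eq: "int_word (l # m # w) = int_mul l (int_word (m # w))" by (simp add: int_word_def)
  show ?case
  proof
    show "right_ideal (hd (l # m # w)) (int_word (l # m # w))" by (simp add: eq right_ideal_int_mul)
    show "\<not> dvd5 (int_word (l # m # w))"
      using dvd5_int_mul right_ideal_inter[OF IH(1)] IH(2) \<open>m \<noteq> inv_letter l\<close> unfolding eq by blast
  qed
next
  case ("2_2" l)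
  obtain g s where l: "l = (g, s)" by (cases l)
  show ?case by (cases g; cases s; simp add: l int_word_def)
qed simp

definition of_ints :: "int \<times> int \<times> int \<times> int \<Rightarrow> real^4" where
  "of_ints x = (case x of (a, b, c, d) \<Rightarrow> quat (of_int a) (of_int b) (of_int c) (of_int d))"

definition letter_quat :: "gen \<times> bool \<Rightarrow> real^4" where
  "letter_quat l = (1 / sqrt 5) *\<^sub>R of_ints (int_mul l (1, 0, 0, 0))"

definition centre :: "gen \<Rightarrow> real^4" where
  "centre g = (case g of Gen_i \<Rightarrow> 0 | Gen_j \<Rightarrow> qone)"

text \<open>
  The rotation by a letter about the centre of its generator. The two centres differ, which
  prevents a common fixed point.
\<close>

definition letter_map :: "gen \<times> bool \<Rightarrow> real^4 \<Rightarrow> real^4" where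
  "letter_map l x = qmul (letter_quat l) (x - centre (fst l)) + centre (fst l)"

definition word_map :: "(gen \<times> bool) list \<Rightarrow> real^4 \<Rightarrow> real^4" where
  "word_map w = foldr letter_map w"

lemma word_map_append: "word_map (u @ v) x = word_map u (word_map v x)"
  by (simp add: word_map_def)

lemma of_ints_int_mul: "of_ints (int_mul l x) = sqrt 5 *\<^sub>R qmul (letter_quat l) (of_ints x)"
proof (cases x)
  case (fields a b c d)
  obtain g s where l: "l = (g, s)" by (cases l)
  show ?thesis
    by (cases g; cases s; simp add: l fields letter_quat_def of_ints_def qmul_def quat_eq_iff field_simps)
qed

lemma norm_letter_quat: "norm (letter_quat l) = 1"
proof -
  obtain g s where l: "l = (g, s)" by (cases l)
  have "(norm (letter_quat l))\<^sup>2 = 1"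
    unfolding norm_quat
    by (cases g; cases s; simp add: l letter_quat_def of_ints_def power_divide)
  then show ?thesis by (simp add: power2_eq_1_iff) (smt (verit) norm_ge_zero)
qed

lemma letter_map_inv: "letter_map l (letter_map (inv_letter l) x) = x"
proof -
  obtain g s where l: "l = (g, s)" by (cases l)
  have "letter_quat (inv_letter l) = qconj (letter_quat l)"
    by (cases g; cases s; simp add: l letter_quat_def inv_letter_def of_ints_def qconj_def quat_eq_iff)
  then show ?thesis by (simp add: letter_map_def inv_letter_def qmul_qconj norm_letter_quat)
qed

lemma dist_letter_map: "dist (letter_map l x) (letter_map l y) = dist x y"
proof -
  have "letter_map l x - letter_map l y = qmul (letter_quat l) (x - y)"
    by (simp add: letter_map_def qmul_diff)
  then show ?thesis by (simp add: dist_norm norm_qmul norm_letter_quat)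
qed

lemma dist_word_map: "dist (word_map w x) (word_map w y) = dist x y"
  by (induction w) (simp_all add: word_map_def dist_letter_map)

lemma word_map_affine:
  "\<exists>v. \<forall>x. word_map w x = qmul ((1 / sqrt 5 ^ length w) *\<^sub>R of_ints (int_word w)) x + v"
proof (induction w)
  case Nil
  show ?case by (intro exI[of _ 0]) (simp add: word_map_def int_word_def of_ints_def)
next
  case (Cons l w)
  define p where "p = (1 / sqrt 5 ^ length w) *\<^sub>R of_ints (int_word w)"
  obtain v where v: "\<And>x. word_map w x = qmul p x + v" using Cons p_def by blast
  have "(1 / sqrt 5 ^ length (l # w)) *\<^sub>R of_ints (int_word (l # w)) = qmul (letter_quat l) p"
    by (simp add: int_word_def of_ints_int_mul p_def qmul_scaleR)
  moreover have "word_map (l # w) x = qmul (qmul (letter_quat l) p) x +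
      (qmul (letter_quat l) (v - centre (fst l)) + centre (fst l))" for x
  proof -
    have "word_map (l # w) x = letter_map l (qmul p x + v)" by (simp add: word_map_def flip: v)
    then show ?thesis by (simp add: letter_map_def qmul_assoc qmul_add qmul_diff)
  qed
  ultimately show ?case by metis
qed

text \<open>
  If the linear part were 1, the integral quaternion would be a real integer whose square is a
  positive power of 5, hence divisible by 5.
\<close>

lemma reduced_word_linear_part:
  assumes "reduced w" "w \<noteq> []"
  shows "(1 / sqrt 5 ^ length w) *\<^sub>R of_ints (int_word w) \<noteq> qone"
proof
  assume eq: "(1 / sqrt 5 ^ length w) *\<^sub>R of_ints (int_word w) = qone"
  obtain a b c d where x: "int_word w = (a, b, c, d)" by (cases "int_word w")
  have "of_int a = sqrt 5 ^ length w" and bcd: "b = 0" "c = 0" "d = 0"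
    using eq by (simp_all add: x of_ints_def quat_eq_iff)
  then have "(of_int a)\<^sup>2 = (5::real) ^ length w"
  proof -
    have "(sqrt 5 ^ length w)\<^sup>2 = ((sqrt 5)\<^sup>2) ^ length w"
      by (simp only: power_mult[symmetric] mult.commute)
    then show ?thesis using \<open>of_int a = sqrt 5 ^ length w\<close> by simp
  qed
  then have "of_int (a\<^sup>2) = (of_int (5 ^ length w) :: real)" by simp
  then have "a\<^sup>2 = 5 ^ length w" unfolding of_int_eq_iff .
  moreover have "(5::int) dvd 5 ^ length w" using assms(2) by (simp add: dvd_power)
  ultimately have "5 dvd a\<^sup>2" by simp
  moreover have "prime (5::int)" by simp
  ultimately have "5 dvd a" by (simp add: prime_dvd_power_iff)
  then have "dvd5 (int_word w)" by (simp add: x bcd)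
  then show False using reduced_word_not_dvd5[OF assms] by blast
qed

text \<open>
  Cancelling adjacent inverse letters does not change the map, so by induction on the length the word
  may be assumed to be reduced.
\<close>

lemma word_map_fixed_point: "\<exists>x. word_map w x = x"
proof (induction "length w" arbitrary: w rule: less_induct)
  case less
  consider "w = []" | "reduced w" "w \<noteq> []" | "\<not> reduced w" by blast
  then show ?case
  proof cases
    case 1
    then show ?thesis by (simp add: word_map_def)
  next
    case 2
    then show ?thesis
      using word_map_affine[of w] affine_qmul_fixed_point[OF reduced_word_linear_part] by metis
  next
    case 3
    then obtain u l v where w: "w = u @ l # inv_letter l # v" by (rule not_reducedE)
    have "\<exists>x. word_map (u @ v) x = x" by (rule less) (simp add: w)
    moreover have "word_map w x = word_map (u @ v) x" for x
      unfolding w word_map_append by (simp add: word_map_def letter_map_inv)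
    ultimately show ?thesis by simp
  qed
qed

lemma word_map_inverse: "\<exists>w'. \<forall>x. word_map w (word_map w' x) = x \<and> word_map w' (word_map w x) = x"
proof (induction w)
  case Nil
  show ?case by (intro exI[of _ "[]"]) (simp add: word_map_def)
next
  case (Cons l w)
  then obtain w' where w': "\<And>x. word_map w (word_map w' x) = x" "\<And>x. word_map w' (word_map w x) = x" by blast
  have "inv_letter (inv_letter l) = l" by (simp add: inv_letter_def)
  then have l: "letter_map (inv_letter l) (letter_map l x) = x" for x
    using letter_map_inv[of "inv_letter l"] by simp
  have 1: "word_map (l # w) x = letter_map l (word_map w x)" for x by (simp add: word_map_def)
  have 2: "word_map (w' @ [inv_letter l]) x = word_map w' (letter_map (inv_letter l) x)" for x
    unfolding word_map_append by (simp add: word_map_def)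
  show ?case
    by (intro exI[of _ "w' @ [inv_letter l]"]) (simp add: 1 2 w' l letter_map_inv)
qed

lemma word_maps_no_common_fixed_point: "\<not> (\<forall>w. word_map w x = x)"
proof
  assume "\<forall>w. word_map w x = x"
  then have *: "letter_map l x = x" for l by (auto simp: word_map_def dest: spec[of _ "[l]"])
  have "x - centre g = 0" for g
  proof (rule qmul_eq_self)
    show "qmul (letter_quat (g, True)) (x - centre g) = x - centre g"
      using *[of "(g, True)"] by (simp add: letter_map_def eq_diff_eq)
    show "letter_quat (g, True) \<noteq> qone"
      by (cases g) (simp_all add: letter_quat_def of_ints_def quat_eq_iff)
  qed
  from this[of Gen_i] this[of Gen_j] show False by (simp add: centre_def quat_eq_iff)
qed

section \<open>Dimension at least five\<close>

definition coords :: "('m::finite \<Rightarrow> 'n::finite) \<Rightarrow> real^'n \<Rightarrow> real^'m" where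
  "coords idx x = (\<chi> j. x $ idx j)"

text \<open>
  The map that acts as \<open>F\<close> on the coordinates in the range of \<open>idx\<close> and leaves the others
  unchanged. If \<open>idx\<close> avoids the last index, then it preserves the last coordinate and hence each
  horosphere centred at infinity, on which it acts as a Euclidean map.
\<close>

definition block :: "('m::finite \<Rightarrow> 'n::finite) \<Rightarrow> (real^'m \<Rightarrow> real^'m) \<Rightarrow> real^'n \<Rightarrow> real^'n" where
  "block idx F x = (\<chi> k. if k \<in> range idx then F (coords idx x) $ (inv_into UNIV idx k) else x $ k)"

context
  fixes idx :: "'m::finite \<Rightarrow> 'n::{finite,linorder}"
  assumes inj: "inj idx" and last: "Max UNIV \<notin> range idx"
begin

lemma coords_block: "coords idx (block idx F x) = F (coords idx x)"
proof -
  have "block idx F x $ idx j = F (coords idx x) $ j" for j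
    using inj by (simp add: block_def)
  then show ?thesis by (simp add: coords_def[of idx "block idx F x"] vec_eq_iff)
qed

lemma block_outside: "k \<notin> range idx \<Longrightarrow> block idx F x $ k = x $ k"
  by (simp add: block_def)

lemma eq_via_coords:
  assumes "coords idx x = coords idx y" "\<And>k. k \<notin> range idx \<Longrightarrow> x $ k = y $ k"
  shows "x = y"
proof -
  have "x $ idx j = y $ idx j" for j using arg_cong[OF assms(1), of "\<lambda>v. v $ j"] by (simp add: coords_def)
  then have "x $ k = y $ k" for k using assms(2) by (cases "k \<in> range idx") auto
  then show ?thesis by (simp add: vec_eq_iff)
qed

lemma norm_coords: "(norm x)\<^sup>2 = (norm (coords idx x))\<^sup>2 + (\<Sum>k\<in>- range idx. (x $ k)\<^sup>2)"
proof -
  have "(norm x)\<^sup>2 = (\<Sum>k\<in>UNIV. (x $ k)\<^sup>2)"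
    unfolding power2_norm_eq_inner by (simp add: inner_vec_def power2_eq_square)
  also have "\<dots> = (\<Sum>k\<in>range idx. (x $ k)\<^sup>2) + (\<Sum>k\<in>- range idx. (x $ k)\<^sup>2)"
    by (subst sum.union_disjoint[symmetric]) (auto simp: Compl_partition)
  also have "(\<Sum>k\<in>range idx. (x $ k)\<^sup>2) = (norm (coords idx x))\<^sup>2"
    unfolding power2_norm_eq_inner using inj
    by (simp add: sum.reindex inner_vec_def coords_def power2_eq_square)
  finally show ?thesis .
qed

lemma hyp_dist_block:
  assumes "\<And>x y. dist (F x) (F y) = dist x y"
  shows "hyp_dist (block idx F x) (block idx F y) = hyp_dist x y"
proof -
  have "coords idx (u - v) = coords idx u - coords idx v" for u v
    by (simp add: coords_def vec_eq_iff)
  then have "coords idx (block idx F x - block idx F y) = F (coords idx x) - F (coords idx y)"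
      "coords idx (x - y) = coords idx x - coords idx y"
    by (simp_all add: coords_block)
  then have "norm (coords idx (block idx F x - block idx F y)) = norm (coords idx (x - y))"
    using assms[of "coords idx x" "coords idx y"] by (simp add: dist_norm)
  moreover have "(\<Sum>k\<in>- range idx. ((block idx F x - block idx F y) $ k)\<^sup>2) = (\<Sum>k\<in>- range idx. ((x - y) $ k)\<^sup>2)"
    by (intro sum.cong) (simp_all add: block_outside)
  ultimately have "(norm (block idx F x - block idx F y))\<^sup>2 = (norm (x - y))\<^sup>2"
    by (simp only: norm_coords[of "_ - _"])
  moreover have "last_coord (block idx F z) = last_coord z" for z
    using last by (simp add: last_coord_def block_outside)
  ultimately show ?thesis by (simp add: hyp_dist_def)
qed

lemma block_hyp_space: "block idx F x \<in> hyp_space \<longleftrightarrow> x \<in> hyp_space"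
  using last by (simp add: hyp_space_def last_coord_def block_outside)

lemma block_comp: "block idx F (block idx G x) = block idx (\<lambda>x. F (G x)) x"
  by (rule eq_via_coords) (simp_all add: coords_block block_outside)

lemma block_eq_self: "block idx F x = x \<longleftrightarrow> F (coords idx x) = coords idx x"
proof
  assume "block idx F x = x" then show "F (coords idx x) = coords idx x" using coords_block[of F x] by simp
next
  assume "F (coords idx x) = coords idx x"
  then show "block idx F x = x" by (intro eq_via_coords) (simp_all add: coords_block block_outside)
qed

lemma coords_surj: "\<exists>x\<in>hyp_space. coords idx x = v"
proof
  let ?x = "\<chi> k. if k \<in> range idx then v $ (inv_into UNIV idx k) else 1"
  show "?x \<in> hyp_space" using last by (simp add: hyp_space_def last_coord_def)
  show "coords idx ?x = v" using inj by (simp add: coords_def vec_eq_iff)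
qed

text \<open>
  A point of hyperbolic space is fixed by \<open>block idx F\<close> if and only if its coordinates in the range of
  \<open>idx\<close> form a fixed point of \<open>F\<close>. So both the fixed points of the single elements
  and the lack of a common one carry over from Euclidean space.
\<close>

lemma not_fixating_of_euclidean:
  fixes S :: "(real^'m \<Rightarrow> real^'m) set"
  assumes iso: "\<And>F x y. F \<in> S \<Longrightarrow> dist (F x) (F y) = dist x y"
    and id: "(\<lambda>x. x) \<in> S"
    and comp: "\<And>F G. F \<in> S \<Longrightarrow> G \<in> S \<Longrightarrow> (\<lambda>x. F (G x)) \<in> S"
    and inv: "\<And>F. F \<in> S \<Longrightarrow> \<exists>G\<in>S. \<forall>x. F (G x) = x \<and> G (F x) = x"
    and fixed: "\<And>F. F \<in> S \<Longrightarrow> \<exists>x. F x = x"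
    and no_common: "\<And>x. \<exists>F\<in>S. F x \<noteq> x"
  shows "\<not> fixating (hyp_space :: (real ^ 'n::{finite,linorder}) set) hyp_isometries"
proof
  let ?X = "hyp_space :: (real ^ 'n::{finite,linorder}) set" and ?I = "hyp_isometries :: (real ^ 'n::{finite,linorder} \<Rightarrow> real ^ 'n::{finite,linorder}) set"
  define H where "H = (\<lambda>F. restrict (block idx F) ?X) ` S"
  assume fixating: "fixating ?X ?I"
  have bij: "restrict (block idx F) ?X \<in> Bij ?X" if F: "F \<in> S" for F
  proof -
    obtain G where G: "\<And>x. F (G x) = x" "\<And>x. G (F x) = x" using inv[OF F] by blast
    have "block idx (\<lambda>x. x) x = x" for x by (simp add: block_eq_self)
    then have "bij_betw (block idx F) ?X ?X"
      by (intro bij_betwI[where g = "block idx G"]) (auto simp: block_comp G block_hyp_space)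
    then show ?thesis by (simp add: Bij_def cong: bij_betw_cong)
  qed
  have compose: "compose ?X (restrict (block idx F) ?X) (restrict (block idx G) ?X) = restrict (block idx (\<lambda>x. F (G x))) ?X" for F G
    by (auto simp: compose_def restrict_def block_comp block_hyp_space)
  have one: "restrict (block idx (\<lambda>x. x)) ?X = (\<lambda>x\<in>?X. x)"
    by (auto simp: restrict_def block_eq_self)
  have "subgroup H (BijGroup ?X)"
  proof (rule group.subgroupI[OF group_BijGroup])
    show "H \<subseteq> carrier (BijGroup ?X)" using bij by (auto simp: H_def BijGroup_def)
    show "H \<noteq> {}" using id by (auto simp: H_def)
    show "f \<otimes>\<^bsub>BijGroup ?X\<^esub> g \<in> H" if fg: "f \<in> H" "g \<in> H" for f g
    proof -
      obtain F G where FG: "f = restrict (block idx F) ?X" "F \<in> S" "g = restrict (block idx G) ?X" "G \<in> S"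
        using fg by (auto simp: H_def)
      have "f \<otimes>\<^bsub>BijGroup ?X\<^esub> g = restrict (block idx (\<lambda>x. F (G x))) ?X"
        using bij FG compose by (simp add: BijGroup_def)
      then show ?thesis using comp FG by (auto simp: H_def)
    qed
    show "inv\<^bsub>BijGroup ?X\<^esub> f \<in> H" if f: "f \<in> H" for f
    proof -
      obtain F where F: "f = restrict (block idx F) ?X" "F \<in> S" using f by (auto simp: H_def)
      obtain G where G: "G \<in> S" "\<And>x. F (G x) = x" "\<And>x. G (F x) = x" using inv[OF F(2)] by blast
      let ?g = "restrict (block idx G) ?X"
      have "?g \<otimes>\<^bsub>BijGroup ?X\<^esub> f = \<one>\<^bsub>BijGroup ?X\<^esub>"
        using bij F G compose[of G F] one by (simp add: BijGroup_def)
      then have "inv\<^bsub>BijGroup ?X\<^esub> f = ?g"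
        using bij F G by (intro group.inv_equality[OF group_BijGroup]) (simp_all add: BijGroup_def)
      then show ?thesis using G by (auto simp: H_def)
    qed
  qed
  moreover have "H \<subseteq> ?I"
    using bij iso by (auto simp: H_def hyp_isometries_def BijGroup_def hyp_dist_block)
  ultimately have "subgroup H ((BijGroup ?X)\<lparr>carrier := ?I\<rparr>)"
    using group.subgroup_incl[OF group_BijGroup _ subgroup_hyp_isometries] by blast
  moreover have "GAF ?X H"
    unfolding GAF_def
  proof
    fix f assume "f \<in> H"
    then obtain F where F: "f = restrict (block idx F) ?X" "F \<in> S" by (auto simp: H_def)
    obtain v where "F v = v" using fixed F(2) by blast
    moreover obtain x where "x \<in> ?X" "coords idx x = v" using coords_surj by blast
    ultimately have "x \<in> Fix ?X f" by (simp add: Fix_def F(1) block_eq_self)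
    then show "Fix ?X f \<noteq> {}" by blast
  qed
  ultimately have "GAG ?X H" using fixating by (simp add: fixating_def)
  then obtain x where x: "\<And>f. f \<in> H \<Longrightarrow> x \<in> Fix ?X f" by (auto simp: GAG_def)
  have "F (coords idx x) = coords idx x" if "F \<in> S" for F
    using x[of "restrict (block idx F) ?X"] that by (auto simp: H_def Fix_def block_eq_self split: if_splits)
  then show False using no_common[of "coords idx x"] by blast
qed

end

theorem not_fixating_hyp_isometries:
  assumes "CARD('n::{finite,linorder}) \<ge> 5"
  shows "\<not> fixating (hyp_space :: (real ^ 'n::{finite,linorder}) set) hyp_isometries"
proof -
  have "card (UNIV :: 4 set) \<le> card (UNIV - {Max UNIV} :: 'n set)" using assms by simp
  then obtain idx :: "4 \<Rightarrow> 'n" where idx: "range idx \<subseteq> UNIV - {Max UNIV}" "inj idx"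
    using card_le_inj[of "UNIV :: 4 set" "UNIV - {Max UNIV} :: 'n set"] by auto
  show ?thesis
  proof (rule not_fixating_of_euclidean[OF idx(2), where S = "range word_map"])
    show "Max UNIV \<notin> range idx" using idx(1) by blast
    show "dist (F x) (F y) = dist x y" if "F \<in> range word_map" for F x y
      using that dist_word_map by auto
    show "(\<lambda>x. x) \<in> range word_map"
      by (rule image_eqI[of _ _ "[]"]) (auto simp: word_map_def)
    show "(\<lambda>x. F (G x)) \<in> range word_map" if FG: "F \<in> range word_map" "G \<in> range word_map" for F G
    proof -
      obtain u v where "F = word_map u" "G = word_map v" using FG by blast
      then have "(\<lambda>x. F (G x)) = word_map (u @ v)" by (simp add: word_map_append fun_eq_iff)
      then show ?thesis by simp
    qed
    show "\<exists>G\<in>range word_map. \<forall>x. F (G x) = x \<and> G (F x) = x" if F: "F \<in> range word_map" for F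
      using F word_map_inverse by blast
    show "\<exists>x. F x = x" if "F \<in> range word_map" for F
      using that word_map_fixed_point by auto
    show "\<exists>F\<in>range word_map. F x \<noteq> x" for x
      using word_maps_no_common_fixed_point by blast
  qed
qed

section \<open>The theorem\<close>

theorem theorem5p8:
  shows "(CARD('n::{finite,linorder}) \<le> 3 \<longrightarrow>
            fixating (hyp_space :: (real ^ 'n::{finite,linorder}) set) hyp_isometries) \<and>
         (CARD('n::{finite,linorder}) \<ge> 5 \<longrightarrow>
            \<not> fixating (hyp_space :: (real ^ 'n::{finite,linorder}) set) hyp_isometries)"
  using fixating_hyp_isometries not_fixating_hyp_isometries by blast

end
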